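(* Let $\phi(s)=\mathbb{E}[e^{-sU_1}]$ be the Laplace–Stieltjes transform of the interarrival time and let $\beta_1=\frac{1-\phi(\mu)}{\phi(\mu)}$. Let $\mathbf p^*\in\mathbb{R}_+^{\{0,\dots,K-1\}}$ be an optimal state-dependent price vector for the $K$-server system, i.e. $R(K,\mathbf p^* )=\max_{\mathbf p}R(K,\mathbf p)$, and let $p^*_K\in\arg\max_{p>0}R(K,p\mathbf 1)$ be an optimal uniform price. Then $$R(K,\mathbf p^* )-R(K,p^*_K\mathbf 1)\;\le\;\frac{1}{\beta_1K}\,R(K,p^*_K\mathbf 1).$$
   Context: $K$-server pricing system ($K\in\mathbb{N}$): jobs arrive at times $A_n=\sum_{i=1}^n U_i$, where the $U_n\ge0$ are i.i.d. with mean $1/\lambda\in(0,\infty)$. Job $n$ has service time $S_n$ (i.i.d. exponential with mean $1/\mu$) and valuation $V_n$ (i.i.d., positive, with continuous distribution function $G$ and finite mean); $(U_n),(S_n),(V_n)$ are mutually independent. Given a price vector $\mathbf p=(p_0,\dots,p_{K-1})\in\mathbb{R}_+^{K}$: if job $n$ finds $Z_n=k$ busy servers on arrival, it is admitted to an idle server and pays $p_k$ if $k\le K-1$ and $V_n\ge p_k$; otherwise (price too high, or $k=K$) it leaves forever, paying nothing. Admitted jobs leave upon service completion. With $N_t$ the number of arrivals in $[0,t]$, the cumulative revenue is $R(t)=\sum_{n=1}^{N_t}\sum_{k=0}^{K-1}p_k\mathbf 1_{\{V_n\ge p_k\}}\mathbf 1_{\{Z_n=k\}}$, and the revenue rate is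 $R(K,\mathbf p)=\lim_{t\to\infty}\mathbb{E}R(t)/t$. $p\mathbf 1$ is the uniform price vector $(p,\dots,p)$. Standing assumption: a finite optimal price vector $\mathbf p^*$ exists. *)

theory Defs
  imports "HOL-Probability.Probability"
begin

text \<open>
  A sample path is given by three real sequences: interarrival times \<open>u\<close>, service times \<open>s\<close> and
  valuations \<open>v\<close>. Jobs are numbered from 1; the entries with index 0 are never used.
\<close>

definition arrival_time :: "(nat \<Rightarrow> real) \<Rightarrow> nat \<Rightarrow> real" where
  "arrival_time u n = (\<Sum>i=1..n. u i)"

definition num_arrivals :: "(nat \<Rightarrow> real) \<Rightarrow> real \<Rightarrow> nat" where
  "num_arrivals u t = card {n. 1 \<le> n \<and> arrival_time u n \<le> t}"

text \<open>
  \<open>busy K p u s v n\<close> is the number \<open>Z\<^sub>n\<close> of servers that job \<open>n\<close> finds busy, the system being empty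
  at time 0. It counts the earlier jobs \<open>m\<close> that were admitted (there was an idle server and the
  valuation was at least the posted price) and whose departure epoch \<open>A\<^sub>m + S\<^sub>m\<close> is later than \<open>A\<^sub>n\<close>.
\<close>

context
  notes conj_cong [fundef_cong]
begin

fun busy ::
  "nat \<Rightarrow> (nat \<Rightarrow> real) \<Rightarrow> (nat \<Rightarrow> real) \<Rightarrow> (nat \<Rightarrow> real) \<Rightarrow> (nat \<Rightarrow> real) \<Rightarrow> nat \<Rightarrow> nat" where
  "busy K p u s v n =
     card {m. m \<in> {1..<n} \<and>
              busy K p u s v m < K \<and> p (busy K p u s v m) \<le> v m \<and>
              arrival_time u n < arrival_time u m + s m}"

end

declare busy.simps [simp del]

definition cumulative_revenue ::
  "nat \<Rightarrow> (nat \<Rightarrow> real) \<Rightarrow> (nat \<Rightarrow> real) \<Rightarrow> (nat \<Rightarrow> real) \<Rightarrow> (nat \<Rightarrow> real) \<Rightarrow> real \<Rightarrow> real" where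
  "cumulative_revenue K p u s v t =
     (\<Sum>n=1..num_arrivals u t. \<Sum>k<K. p k * of_bool (p k \<le> v n) * of_bool (busy K p u s v n = k))"

definition revenue_rate ::
  "'a measure \<Rightarrow> (nat \<Rightarrow> 'a \<Rightarrow> real) \<Rightarrow> (nat \<Rightarrow> 'a \<Rightarrow> real) \<Rightarrow> (nat \<Rightarrow> 'a \<Rightarrow> real) \<Rightarrow>
     nat \<Rightarrow> (nat \<Rightarrow> real) \<Rightarrow> real" where
  "revenue_rate M U S V K p =
     Lim at_top (\<lambda>t. (\<integral>\<omega>. cumulative_revenue K p (\<lambda>n. U n \<omega>) (\<lambda>n. S n \<omega>) (\<lambda>n. V n \<omega>) t \<partial>M) / t)"

text \<open>
  Price vectors \<open>(p\<^sub>0, \<dots>, p\<^bsub>K-1\<^esub>)\<close> with nonnegative entries; values at indices \<open>\<ge> K\<close> are irrelevant,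
  since no price is ever looked up there. The uniform price vector with price \<open>x\<close> is \<open>\<lambda>_. x\<close>.
\<close>

definition price_vectors :: "nat \<Rightarrow> (nat \<Rightarrow> real) set" where
  "price_vectors K = {..<K} \<rightarrow> {0..}"

definition laplace_stieltjes :: "'a measure \<Rightarrow> ('a \<Rightarrow> real) \<Rightarrow> real \<Rightarrow> real" where
  "laplace_stieltjes M X s = (\<integral>\<omega>. exp (- s * X \<omega>) \<partial>M)"

text \<open>
  The sum type in the joint independence assumption merely merges the three sequences into one
  independent family.
\<close>

locale pricing_system = prob_space M
  for M :: "'a measure" +
  fixes U S V :: "nat \<Rightarrow> 'a \<Rightarrow> real" and arr_rate \<mu> :: real
  assumes rate_pos: "0 < arr_rate" "0 < \<mu>"
    and indep: "indep_vars (\<lambda>_. borel) (case_sum U (case_sum S V)) ({1..} <+> {1..} <+> {1..})"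
    and U_distr: "\<And>n. 1 \<le> n \<Longrightarrow> distr M borel (U n) = distr M borel (U 1)"
    and U_nonneg: "\<And>n. 1 \<le> n \<Longrightarrow> AE \<omega> in M. 0 \<le> U n \<omega>"
    and U_mean: "integrable M (U 1)" "expectation (U 1) = 1 / arr_rate"
    and S_exponential: "\<And>n. 1 \<le> n \<Longrightarrow> distributed M lborel (S n) (exponential_density \<mu>)"
    and V_distr: "\<And>n. 1 \<le> n \<Longrightarrow> distr M borel (V n) = distr M borel (V 1)"
    and V_pos: "\<And>n. 1 \<le> n \<Longrightarrow> AE \<omega> in M. 0 < V n \<omega>"
    and V_cdf_continuous: "continuous_on UNIV (cdf (distr M borel (V 1)))"
    and V_mean: "integrable M (V 1)"

end

theory Submission
  imports Defs
begin

text \<open>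
  Let \<open>r(x) = x P(V \<ge> x)\<close>, let \<open>m(t)\<close> be the mean number of arrivals in \<open>[0, t]\<close> and \<open>h\<^sub>k(t)\<close> the mean
  number of those that find \<open>k\<close> busy servers. As \<open>V\<^sub>n\<close> is independent of what job \<open>n\<close> finds,
  \<open>E R(t)\<close> equals the sum of \<open>r(p\<^sub>k) h\<^sub>k(t)\<close> over \<open>k < K\<close>, which is at most \<open>r(x) m(t)\<close> for the price
  \<open>x\<close> among the \<open>p\<^sub>k\<close> with the largest \<open>r\<close>. The uniform price \<open>x\<close> earns \<open>r(x) (m(t) - h\<^sub>K(t))\<close>. Each
  job in service is still there at the next arrival with probability \<open>\<phi>(\<mu>)\<close>, so the balance of the mean number
  of busy servers gives \<open>\<beta>\<^sub>1 K h\<^sub>K(t) \<le> m(t) - h\<^sub>K(t)\<close>. Hence, at every time \<open>t\<close>, the uniform price loses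
  at most the factor \<open>1 + 1 / (\<beta>\<^sub>1 K)\<close>.

  To pass to the rates, the limits have to exist. Wald's identity shows that \<open>m(t) / t\<close> converges.
  Exponential service times make the number of busy servers found by successive arrivals a Markov
  chain, \<open>h(t)\<close> is stationary for it up to a bounded error, and Doeblin's contraction argument turns
  this into the Cauchy property of \<open>h(t) / t\<close>.
\<close>

section \<open>Sample paths\<close>

text \<open>Two obstacles shape the proof. \<open>revenue_rate\<close> is a \<open>Lim\<close>,
  which carries information only once a limit is known to exist. The comparison of revenues at a
  fixed t is short; much of the remaining work is convergence, for every price vector and for an
  arbitrary interarrival law with finite positive mean. No stationary law is constructed, since
  differences of h(t)/t at two times suffice. Secondly, counting up to a time t instead of a number
  of jobs ties the horizon to the path. The event A_n <= t is decided by the first n interarrival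
  times and is independent of U_{n+1}, so the step from job n to job n+1 stays correct on it; this
  is why the renewal and the Markov statements carry A_n <= t along. The Markov property is
  elementary independence: fix which jobs are in service, freeze everything except their service
  times and the next interarrival time, and use memorylessness. Interarrival times are nonnegative
  only almost surely; passing to \<open>max 0 (U n)\<close> makes the pathwise facts hold at every
  sample point.\<close>

definition admitted ::
  "nat \<Rightarrow> (nat \<Rightarrow> real) \<Rightarrow> (nat \<Rightarrow> real) \<Rightarrow> (nat \<Rightarrow> real) \<Rightarrow> (nat \<Rightarrow> real) \<Rightarrow> nat \<Rightarrow> bool" where
  "admitted K p u s v m \<longleftrightarrow> busy K p u s v m < K \<and> p (busy K p u s v m) \<le> v m"

text \<open>The jobs in the system just after the decision on job \<open>n\<close>, itself included.
  The set is recorded instead of its size because the Markov step must know whose service times are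
  still unresolved.\<close>

definition in_service ::
  "nat \<Rightarrow> (nat \<Rightarrow> real) \<Rightarrow> (nat \<Rightarrow> real) \<Rightarrow> (nat \<Rightarrow> real) \<Rightarrow> (nat \<Rightarrow> real) \<Rightarrow> nat \<Rightarrow> nat set" where
  "in_service K p u s v n =
     {m \<in> {1..n}. admitted K p u s v m \<and> arrival_time u n < arrival_time u m + s m}"

lemma busy_eq_card_admitted:
  "busy K p u s v n =
     card {m \<in> {1..<n}. admitted K p u s v m \<and> arrival_time u n < arrival_time u m + s m}"
  by (subst busy.simps) (simp add: admitted_def conj_assoc)

text \<open>The recursion sees service and interarrival times only through comparisons of arrival
  with departure epochs. This lets service times be overridden, coordinates be read off from a block
  of variables, and \<open>U n\<close> be replaced by \<open>max 0 (U n)\<close>.\<close>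

lemma busy_cong:
  assumes "\<And>m. m \<in> {1..<n} \<Longrightarrow> v m = v' m"
    and "\<And>m l. 1 \<le> m \<Longrightarrow> m < l \<Longrightarrow> l \<le> n \<Longrightarrow>
      arrival_time u l < arrival_time u m + s m \<longleftrightarrow> arrival_time u' l < arrival_time u' m + s' m"
  shows "busy K p u s v n = busy K p u' s' v' n"
  using assms
proof (induction n rule: less_induct)
  case (less n)
  have "busy K p u s v m = busy K p u' s' v' m" if "m \<in> {1..<n}" for m
    using that by (intro less.IH less.prems) auto
  hence "admitted K p u s v m = admitted K p u' s' v' m" if "m \<in> {1..<n}" for m
    using that less.prems(1) by (simp add: admitted_def)
  thus ?case
    unfolding busy_eq_card_admitted using less.prems(2)
    by (intro arg_cong[where f=card]) auto
qed

lemma admitted_cong: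
  assumes "\<And>m. m \<in> {1..n} \<Longrightarrow> v m = v' m" "1 \<le> n"
    and "\<And>m l. 1 \<le> m \<Longrightarrow> m < l \<Longrightarrow> l \<le> n \<Longrightarrow>
      arrival_time u l < arrival_time u m + s m \<longleftrightarrow> arrival_time u' l < arrival_time u' m + s' m"
  shows "admitted K p u s v n = admitted K p u' s' v' n"
proof -
  have "busy K p u s v n = busy K p u' s' v' n"
    by (rule busy_cong) (use assms in auto)
  thus ?thesis using assms(1)[of n] assms(2) by (simp add: admitted_def)
qed

lemma in_service_cong:
  assumes "\<And>m. m \<in> {1..n} \<Longrightarrow> v m = v' m"
    and "\<And>m l. 1 \<le> m \<Longrightarrow> m \<le> l \<Longrightarrow> l \<le> n \<Longrightarrow>
      arrival_time u l < arrival_time u m + s m \<longleftrightarrow> arrival_time u' l < arrival_time u' m + s' m"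
  shows "in_service K p u s v n = in_service K p u' s' v' n"
proof -
  have "admitted K p u s v m = admitted K p u' s' v' m" if "m \<in> {1..n}" for m
    by (rule admitted_cong) (use assms that in auto)
  thus ?thesis
    unfolding in_service_def using assms(2) by auto
qed

lemma arrival_time_Suc: "arrival_time u (Suc n) = arrival_time u n + u (Suc n)"
  by (simp add: arrival_time_def)

lemma arrival_time_mono:
  assumes "\<And>n. 1 \<le> n \<Longrightarrow> 0 \<le> u n" "m \<le> n"
  shows "arrival_time u m \<le> arrival_time u n"
  unfolding arrival_time_def using assms by (intro sum_mono2) auto

text \<open>With nonnegative interarrival times, a job gone at A_n is still gone at A_{n+1}.\<close>

lemma busy_Suc_eq_card:
  assumes "\<And>n. 1 \<le> n \<Longrightarrow> 0 \<le> u n"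
  shows "busy K p u s v (Suc n) =
    card {m \<in> in_service K p u s v n. arrival_time u (Suc n) < arrival_time u m + s m}"
proof -
  have "arrival_time u n \<le> arrival_time u (Suc n)"
    using assms by (intro arrival_time_mono) auto
  thus ?thesis
    unfolding busy_eq_card_admitted[of K p u s v "Suc n"] in_service_def
    by (intro arg_cong[where f=card]) auto
qed

lemma card_in_service:
  assumes "1 \<le> n" "0 < s n"
  shows "card (in_service K p u s v n) = busy K p u s v n + of_bool (admitted K p u s v n)"
proof -
  let ?A = "{m \<in> {1..<n}. admitted K p u s v m \<and> arrival_time u n < arrival_time u m + s m}"
  have "in_service K p u s v n = ?A \<union> (if admitted K p u s v n then {n} else {})"
    using assms by (force simp: in_service_def le_less)
  moreover have "card (?A \<union> (if admitted K p u s v n then {n} else {})) =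
      card ?A + card (if admitted K p u s v n then {n} else {})"
    by (rule card_Un_disjoint) auto
  ultimately show ?thesis
    by (simp add: busy_eq_card_admitted[of K p u s v n])
qed

lemma busy_le:
  assumes "\<And>n. 1 \<le> n \<Longrightarrow> 0 \<le> u n"
  shows "busy K p u s v n \<le> K"
proof (induction n)
  case 0
  show ?case by (simp add: busy_eq_card_admitted[of K p u s v 0])
next
  case (Suc n)
  show ?case
  proof (cases "n = 0")
    case True
    thus ?thesis by (simp add: busy_eq_card_admitted[of K p u s v "Suc 0"])
  next
    case False
    let ?A = "{m \<in> {1..<n}. admitted K p u s v m \<and> arrival_time u n < arrival_time u m + s m}"
    let ?B = "if admitted K p u s v n then {n} else {}"
    have le: "arrival_time u n \<le> arrival_time u (Suc n)"
      using assms by (intro arrival_time_mono) auto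
    have "busy K p u s v (Suc n) \<le> card (?A \<union> ?B)"
      unfolding busy_eq_card_admitted[of K p u s v "Suc n"] using le
      by (intro card_mono) (auto simp: less_Suc_eq)
    also have "\<dots> \<le> card ?A + card ?B" by (rule card_Un_le)
    also have "card ?A = busy K p u s v n" by (rule busy_eq_card_admitted[symmetric])
    also have "busy K p u s v n + card ?B \<le> K"
      using Suc by (auto simp: admitted_def)
    finally show ?thesis .
  qed
qed

text \<open>
  Since the jobs of \<open>b\<close> are still in service, their exact service times have had no influence so far.
  Overriding them splits the event \<open>in_service = b\<close> into a part that does not depend on these service
  times and the lower bounds on them; conditionally on the former, the residual service times are
  therefore independent and exponential.
\<close>

lemma in_service_iff_override:
  fixes s :: "nat \<Rightarrow> real"
  assumes nn: "\<And>n. 1 \<le> n \<Longrightarrow> 0 \<le> u n" and b: "b \<subseteq> {1..n}"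
  defines "s' \<equiv> \<lambda>m. if m \<in> b then arrival_time u n - arrival_time u m + 1 else s m"
  shows "in_service K p u s v n = b \<longleftrightarrow>
    in_service K p u s' v n = b \<and> (\<forall>m\<in>b. arrival_time u n - arrival_time u m < s m)"
proof -
  have "in_service K p u s v n = in_service K p u s' v n"
    if "\<forall>m\<in>b. arrival_time u n - arrival_time u m < s m"
  proof (rule in_service_cong)
    fix m l assume ml: "1 \<le> m" "m \<le> l" "l \<le> n"
    \<comment> \<open>For \<open>m\<close> in \<open>b\<close>, both \<open>s m\<close> and the
      override exceed A_n - A_m, so both comparisons are true at A_l for every l <= n. Any positive
      number could stand for the added 1.\<close>
    have "arrival_time u l \<le> arrival_time u n"
      using nn ml by (intro arrival_time_mono) auto
    thus "arrival_time u l < arrival_time u m + s m \<longleftrightarrow>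
        arrival_time u l < arrival_time u m + s' m"
      using that by (force simp: s'_def)
  qed simp
  moreover have "\<forall>m\<in>b. arrival_time u n - arrival_time u m < s m"
    if "in_service K p u s v n = b"
    using that by (auto simp: in_service_def)
  ultimately show ?thesis by blast
qed

text \<open>Arrival epochs increase, so the jobs arrived by t form an initial segment. Finiteness is
  assumed because \<open>card\<close>, and with it \<open>num_arrivals\<close>, is 0 on infinite
  sets.\<close>

lemma image_Suc_arrivals:
  assumes nn: "\<And>n. 1 \<le> n \<Longrightarrow> 0 \<le> u n" and fin: "finite {n. arrival_time u (Suc n) \<le> t}"
  shows "Suc ` {n. arrival_time u (Suc n) \<le> t} = {1..num_arrivals u t}"
proof -
  define B where "B = {n. 1 \<le> n \<and> arrival_time u n \<le> t}"
  have B: "B = Suc ` {n. arrival_time u (Suc n) \<le> t}"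
  proof (intro set_eqI iffI)
    fix n assume "n \<in> B"
    thus "n \<in> Suc ` {n. arrival_time u (Suc n) \<le> t}" by (cases n) (auto simp: B_def)
  qed (auto simp: B_def)
  hence finB: "finite B" using fin by simp
  have "B = {1..card B}"
  proof (cases "B = {}")
    case False
    have down: "m \<in> B" if "n \<in> B" "1 \<le> m" "m \<le> n" for m n
      using that arrival_time_mono[of u m n, OF nn] by (auto simp: B_def)
    have "B \<subseteq> {1..Max B}"
    proof
      fix n assume "n \<in> B"
      thus "n \<in> {1..Max B}" using Max_ge[OF finB, of n] by (simp add: B_def)
    qed
    moreover have "{1..Max B} \<subseteq> B"
    proof
      fix m assume "m \<in> {1..Max B}"
      thus "m \<in> B" using down[OF Max_in[OF finB False], of m] by simp
    qed
    ultimately have eq: "B = {1..Max B}" by simp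
    hence "card B = card {1..Max B}" by (rule arg_cong)
    thus ?thesis using eq by simp
  qed simp
  thus ?thesis unfolding B[symmetric] by (simp add: num_arrivals_def B_def)
qed

lemma card_Collect_eq_sum: "finite A \<Longrightarrow> card {x \<in> A. Q x} = (\<Sum>x\<in>A. of_bool (Q x))"
  by (simp add: of_bool_def sum.If_cases Int_def)

section \<open>Measurability of the path functionals\<close>

lemma measurable_arrival_time:
  assumes "\<And>i. 1 \<le> i \<Longrightarrow> i \<le> n \<Longrightarrow> (\<lambda>\<omega>. u i \<omega>) \<in> borel_measurable N"
  shows "(\<lambda>\<omega>. arrival_time (\<lambda>i. u i \<omega>) n) \<in> borel_measurable N"
  unfolding arrival_time_def using assms by (intro borel_measurable_sum) auto

text \<open>\<open>N\<close> is arbitrary so that this serves on product spaces of coordinates as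
  well as on \<open>M\<close>. The bound \<open>i < n\<close> for service times and valuations
  matters: what job \<open>n\<close> finds must be measurable without its own.\<close>

lemma measurable_busy_admitted:
  assumes u: "\<And>i. 1 \<le> i \<Longrightarrow> i \<le> n \<Longrightarrow> (\<lambda>\<omega>. u i \<omega>) \<in> borel_measurable N"
    and s: "\<And>i. 1 \<le> i \<Longrightarrow> i < n \<Longrightarrow> (\<lambda>\<omega>. s i \<omega>) \<in> borel_measurable N"
    and v: "\<And>i. 1 \<le> i \<Longrightarrow> i < n \<Longrightarrow> (\<lambda>\<omega>. v i \<omega>) \<in> borel_measurable N"
  shows measurable_busy: "(\<lambda>\<omega>. busy K p (\<lambda>i. u i \<omega>) (\<lambda>i. s i \<omega>) (\<lambda>i. v i \<omega>) n) \<in> measurable N (count_space UNIV)"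
    and measurable_admitted: "1 \<le> n \<Longrightarrow> v n \<in> borel_measurable N \<Longrightarrow>
      Measurable.pred N (\<lambda>\<omega>. admitted K p (\<lambda>i. u i \<omega>) (\<lambda>i. s i \<omega>) (\<lambda>i. v i \<omega>) n)"
proof -
  let ?Z = "\<lambda>n \<omega>. busy K p (\<lambda>i. u i \<omega>) (\<lambda>i. s i \<omega>) (\<lambda>i. v i \<omega>) n"
  let ?adm = "\<lambda>n \<omega>. admitted K p (\<lambda>i. u i \<omega>) (\<lambda>i. s i \<omega>) (\<lambda>i. v i \<omega>) n"
  have adm: "Measurable.pred N (?adm m)"
    if [measurable]: "?Z m \<in> measurable N (count_space UNIV)" "v m \<in> borel_measurable N" for m
    unfolding admitted_def by measurable
  show Z: "?Z n \<in> measurable N (count_space UNIV)"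
    using assms
  proof (induction n rule: less_induct)
    case (less n)
    have eq: "?Z n = (\<lambda>\<omega>. \<Sum>m\<in>{1..<n}. of_bool (?adm m \<omega> \<and>
        arrival_time (\<lambda>i. u i \<omega>) n < arrival_time (\<lambda>i. u i \<omega>) m + s m \<omega>))"
      by (rule ext, subst busy_eq_card_admitted, rule card_Collect_eq_sum) simp
    show ?case unfolding eq of_bool_def
    proof (rule measurable_sum_nat)
      fix m assume m: "m \<in> {1..<n}"
      have [measurable]: "Measurable.pred N (?adm m)"
        using m by (intro adm less.IH less.prems) auto
      have [measurable]: "(\<lambda>\<omega>. arrival_time (\<lambda>i. u i \<omega>) m) \<in> borel_measurable N"
          "(\<lambda>\<omega>. arrival_time (\<lambda>i. u i \<omega>) n) \<in> borel_measurable N"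
        using m less.prems(1) by (auto intro!: measurable_arrival_time)
      have [measurable]: "s m \<in> borel_measurable N"
        using m less.prems(2) by auto
      show "(\<lambda>\<omega>. if ?adm m \<omega> \<and> arrival_time (\<lambda>i. u i \<omega>) n < arrival_time (\<lambda>i. u i \<omega>) m + s m \<omega>
          then 1 else 0) \<in> measurable N (count_space UNIV)"
        by measurable
    qed
  qed
  show "Measurable.pred N (?adm n)" if "1 \<le> n" "v n \<in> borel_measurable N"
    using Z that by (rule_tac adm)
qed

lemma measurable_in_service:
  assumes u: "\<And>i. 1 \<le> i \<Longrightarrow> i \<le> n \<Longrightarrow> (\<lambda>\<omega>. u i \<omega>) \<in> borel_measurable N"
    and s: "\<And>i. 1 \<le> i \<Longrightarrow> i \<le> n \<Longrightarrow> (\<lambda>\<omega>. s i \<omega>) \<in> borel_measurable N"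
    and v: "\<And>i. 1 \<le> i \<Longrightarrow> i \<le> n \<Longrightarrow> (\<lambda>\<omega>. v i \<omega>) \<in> borel_measurable N"
  shows "Measurable.pred N (\<lambda>\<omega>. in_service K p (\<lambda>i. u i \<omega>) (\<lambda>i. s i \<omega>) (\<lambda>i. v i \<omega>) n = b)"
proof (cases "b \<subseteq> {1..n}")
  case True
  let ?adm = "\<lambda>n \<omega>. admitted K p (\<lambda>i. u i \<omega>) (\<lambda>i. s i \<omega>) (\<lambda>i. v i \<omega>) n"
  have "in_service K p (\<lambda>i. u i \<omega>) (\<lambda>i. s i \<omega>) (\<lambda>i. v i \<omega>) n = b \<longleftrightarrow>
     (\<forall>m\<in>{1..n}. (?adm m \<omega> \<and> arrival_time (\<lambda>i. u i \<omega>) n < arrival_time (\<lambda>i. u i \<omega>) m + s m \<omega>)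
       = (m \<in> b))" for \<omega>
    unfolding in_service_def using True by auto
  moreover have "Measurable.pred N (\<lambda>\<omega>. \<forall>m\<in>{1..n}. (?adm m \<omega> \<and>
      arrival_time (\<lambda>i. u i \<omega>) n < arrival_time (\<lambda>i. u i \<omega>) m + s m \<omega>) = (m \<in> b))"
  proof (rule pred_intros_finite)
    fix m assume m: "m \<in> {1..n}"
    have [measurable]: "Measurable.pred N (?adm m)"
      using m by (intro measurable_admitted assms) auto
    have [measurable]: "(\<lambda>\<omega>. arrival_time (\<lambda>i. u i \<omega>) m) \<in> borel_measurable N"
        "(\<lambda>\<omega>. arrival_time (\<lambda>i. u i \<omega>) n) \<in> borel_measurable N"
      using m u by (auto intro!: measurable_arrival_time)
    have [measurable]: "s m \<in> borel_measurable N"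
      using m s by auto
    show "Measurable.pred N (\<lambda>\<omega>. (?adm m \<omega> \<and>
      arrival_time (\<lambda>i. u i \<omega>) n < arrival_time (\<lambda>i. u i \<omega>) m + s m \<omega>) = (m \<in> b))"
      by measurable
  qed simp
  ultimately show ?thesis by simp
next
  case False
  hence "in_service K p (\<lambda>i. u i \<omega>) (\<lambda>i. s i \<omega>) (\<lambda>i. v i \<omega>) n \<noteq> b" for \<omega>
    by (auto simp: in_service_def)
  thus ?thesis by simp
qed

section \<open>Almost stationary measures of a finite chain\<close>

lemma tendsto_at_top_if_Cauchy:
  fixes f :: "real \<Rightarrow> real"
  assumes "\<And>\<epsilon>. 0 < \<epsilon> \<Longrightarrow> \<exists>T. \<forall>t\<ge>T. \<forall>t'\<ge>T. \<bar>f t - f t'\<bar> < \<epsilon>"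
  shows "\<exists>L. (f \<longlongrightarrow> L) at_top"
proof -
  have "Cauchy (\<lambda>n. f (real n))"
  proof (rule metric_CauchyI)
    fix e :: real assume "0 < e"
    then obtain T where T: "\<forall>t\<ge>T. \<forall>t'\<ge>T. \<bar>f t - f t'\<bar> < e" using assms by blast
    obtain N :: nat where "T \<le> real N" using real_arch_simple by blast
    thus "\<exists>M. \<forall>m\<ge>M. \<forall>n\<ge>M. dist (f (real m)) (f (real n)) < e"
      using T by (intro exI[of _ N]) (auto simp: dist_real_def)
  qed
  then obtain L where L: "(\<lambda>n. f (real n)) \<longlonglongrightarrow> L"
    using Cauchy_convergent convergent_def by blast
  have "(f \<longlongrightarrow> L) at_top"
  proof (rule tendstoI)
    fix e :: real assume "0 < e"
    then obtain T where T: "\<forall>t\<ge>T. \<forall>t'\<ge>T. \<bar>f t - f t'\<bar> < e / 2" using assms[of "e/2"] by auto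
    obtain N where N: "\<And>n. N \<le> n \<Longrightarrow> dist (f (real n)) L < e / 2"
      using metric_LIMSEQ_D[OF L, of "e/2"] \<open>0 < e\<close> by auto
    define n where "n = max N (nat \<lceil>T\<rceil>)"
    have n: "dist (f (real n)) L < e / 2" "T \<le> real n"
      using N[of n] real_nat_ceiling_ge[of T] unfolding n_def by (auto simp: max_def)
    have "dist (f t) L < e" if "T \<le> t" for t
    proof -
      have "\<bar>f t - f (real n)\<bar> < e / 2" using T that n(2) by blast
      thus ?thesis using n(1) unfolding dist_real_def by linarith
    qed
    thus "\<forall>\<^sub>F t in at_top. dist (f t) L < e"
      by (auto simp: eventually_at_top_linorder)
  qed
  thus ?thesis by blast
qed

text \<open>
  Doeblin's argument: \<open>\<delta>\<close> times the unit mass at state 0 can be split off every row of \<open>P\<close>, so \<open>P\<close>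
  contracts differences of total mass 0 by \<open>1 - \<delta>\<close>.
\<close>

lemma doeblin_l1_bound:
  fixes P :: "nat \<Rightarrow> nat \<Rightarrow> real" and d e :: "nat \<Rightarrow> real"
  assumes P_nonneg: "\<And>i j. i \<le> K \<Longrightarrow> j \<le> K \<Longrightarrow> 0 \<le> P i j"
    and P_sum: "\<And>i. i \<le> K \<Longrightarrow> (\<Sum>j\<le>K. P i j) = 1"
    and \<delta>: "0 < \<delta>" "\<And>i. i \<le> K \<Longrightarrow> \<delta> \<le> P i 0"
    and d: "\<And>j. j \<le> K \<Longrightarrow> d j = (\<Sum>i\<le>K. d i * P i j) + e j"
  shows "\<delta> * (\<Sum>j\<le>K. \<bar>d j\<bar>) \<le> \<delta> * \<bar>\<Sum>j\<le>K. d j\<bar> + (\<Sum>j\<le>K. \<bar>e j\<bar>)"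
proof -
  \<comment> \<open>\<open>I\<close> is the part common to all rows. The remainders
    \<open>P i j - I j\<close> are nonnegative with row sums 1 - \<delta>, whence the contraction;
    the split-off part sees \<open>d\<close> only through its total mass.\<close>
  define I where "I = (\<lambda>j::nat. if j = 0 then \<delta> else 0)"
  have sumI: "(\<Sum>j\<le>K. I j) = \<delta>" unfolding I_def by (simp add: sum.delta)
  have I: "0 \<le> I j" "i \<le> K \<Longrightarrow> j \<le> K \<Longrightarrow> 0 \<le> P i j - I j" for i j
    using \<delta> P_nonneg by (auto simp: I_def)
  have bound: "\<bar>d j\<bar> \<le> (\<Sum>i\<le>K. \<bar>d i\<bar> * (P i j - I j)) + I j * \<bar>\<Sum>i\<le>K. d i\<bar> + \<bar>e j\<bar>"
    if j: "j \<le> K" for j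
  proof -
    have "d j = (\<Sum>i\<le>K. d i * (P i j - I j)) + I j * (\<Sum>i\<le>K. d i) + e j"
      using d[OF j] by (simp add: algebra_simps sum_subtractf sum_distrib_left)
    hence "\<bar>d j\<bar> \<le> \<bar>\<Sum>i\<le>K. d i * (P i j - I j)\<bar> + \<bar>I j * (\<Sum>i\<le>K. d i)\<bar> + \<bar>e j\<bar>"
      by linarith
    also have "\<bar>\<Sum>i\<le>K. d i * (P i j - I j)\<bar> \<le> (\<Sum>i\<le>K. \<bar>d i * (P i j - I j)\<bar>)"
      by (rule sum_abs)
    also have "\<dots> = (\<Sum>i\<le>K. \<bar>d i\<bar> * (P i j - I j))"
      using I(2) j by (intro sum.cong) (auto simp: abs_mult)
    also have "\<bar>I j * (\<Sum>i\<le>K. d i)\<bar> = I j * \<bar>\<Sum>i\<le>K. d i\<bar>"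
      using I(1) by (simp add: abs_mult)
    finally show ?thesis by simp
  qed
  have "(\<Sum>j\<le>K. \<bar>d j\<bar>) \<le>
      (\<Sum>j\<le>K. (\<Sum>i\<le>K. \<bar>d i\<bar> * (P i j - I j)) + I j * \<bar>\<Sum>i\<le>K. d i\<bar> + \<bar>e j\<bar>)"
    using bound by (intro sum_mono) auto
  also have "\<dots> = (\<Sum>i\<le>K. \<bar>d i\<bar> * (\<Sum>j\<le>K. P i j - I j)) + \<delta> * \<bar>\<Sum>i\<le>K. d i\<bar> + (\<Sum>j\<le>K. \<bar>e j\<bar>)"
    unfolding sum.distrib sum_distrib_left sum_distrib_right[symmetric] sumI
    by (subst sum.swap) simp
  also have "(\<Sum>i\<le>K. \<bar>d i\<bar> * (\<Sum>j\<le>K. P i j - I j)) = (\<Sum>i\<le>K. \<bar>d i\<bar>) * (1 - \<delta>)"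
    unfolding sum_subtractf sumI by (simp add: P_sum sum_distrib_right)
  finally show ?thesis by (simp add: algebra_simps)
qed

text \<open>The difference of h(t)/t and h(t')/t' is stationary up to an error of order 1/T for t,
  t' >= T, and its total mass is small because the totals converge. The l1 bound then makes every
  component small.\<close>

lemma tendsto_if_almost_stationary:
  fixes P :: "nat \<Rightarrow> nat \<Rightarrow> real" and h :: "nat \<Rightarrow> real \<Rightarrow> real"
  assumes P_nonneg: "\<And>i j. i \<le> K \<Longrightarrow> j \<le> K \<Longrightarrow> 0 \<le> P i j"
    and P_sum: "\<And>i. i \<le> K \<Longrightarrow> (\<Sum>j\<le>K. P i j) = 1"
    and \<delta>: "0 < \<delta>" "\<And>i. i \<le> K \<Longrightarrow> \<delta> \<le> P i 0"
    and h: "\<And>j t. j \<le> K \<Longrightarrow> 0 \<le> t \<Longrightarrow> \<bar>h j t - (\<Sum>i\<le>K. h i t * P i j)\<bar> \<le> 1"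
    and lim: "((\<lambda>t. (\<Sum>j\<le>K. h j t) / t) \<longlongrightarrow> c) at_top"
    and k: "k \<le> K"
  shows "\<exists>L. ((\<lambda>t. h k t / t) \<longlongrightarrow> L) at_top"
proof (rule tendsto_at_top_if_Cauchy)
  fix \<epsilon> :: real assume \<epsilon>: "0 < \<epsilon>"
  let ?s = "\<lambda>t. \<Sum>j\<le>K. h j t"
  have "eventually (\<lambda>t. dist (?s t / t) c < \<epsilon> / 4) at_top"
    using tendstoD[OF lim, of "\<epsilon> / 4"] \<epsilon> by simp
  then obtain T1 where T1: "\<And>t. T1 \<le> t \<Longrightarrow> dist (?s t / t) c < \<epsilon> / 4"
    by (auto simp: eventually_at_top_linorder)
  \<comment> \<open>The errors add up to at most 2 (K + 1) / T; the second bound on \<open>T\<close>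
    brings this below \<delta> \<epsilon> / 4.\<close>
  define T where "T = max (max 1 T1) (8 * (real K + 1) / (\<delta> * \<epsilon>))"
  have "\<bar>h k t / t - h k t' / t'\<bar> < \<epsilon>" if t: "T \<le> t" "T \<le> t'" for t t'
  proof -
    have pos: "1 \<le> t" "1 \<le> t'" "T1 \<le> t" "T1 \<le> t'" using t by (auto simp: T_def)
    define d where "d j = h j t / t - h j t' / t'" for j
    define e where "e j = d j - (\<Sum>i\<le>K. d i * P i j)" for j
    have e: "\<bar>e j\<bar> \<le> 2 / T" if j: "j \<le> K" for j
    proof -
      have T0: "0 < T" by (simp add: T_def)
      have small: "\<bar>(h j r - (\<Sum>i\<le>K. h i r * P i j)) / r\<bar> \<le> 1 / T" if "1 \<le> r" "T \<le> r" for r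
        using h[OF j, of r] that T0 by (auto simp: abs_divide intro!: frac_le)
      have "e j = (h j t - (\<Sum>i\<le>K. h i t * P i j)) / t - (h j t' - (\<Sum>i\<le>K. h i t' * P i j)) / t'"
        unfolding e_def d_def
        by (simp add: diff_divide_distrib left_diff_distrib sum_subtractf sum_divide_distrib)
      thus ?thesis using small[of t] small[of t'] pos t by linarith
    qed
    have "\<delta> * (\<Sum>j\<le>K. \<bar>d j\<bar>) \<le> \<delta> * \<bar>\<Sum>j\<le>K. d j\<bar> + (\<Sum>j\<le>K. \<bar>e j\<bar>)"
      by (rule doeblin_l1_bound[OF P_nonneg P_sum \<delta>]) (auto simp: e_def)
    also have "(\<Sum>j\<le>K. \<bar>e j\<bar>) \<le> (\<Sum>j\<le>K. 2 / T)"
      using e by (intro sum_mono) auto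
    also have "\<dots> = 2 * (real K + 1) / T" by simp
    also have "\<dots> \<le> \<delta> * \<epsilon> / 4"
    proof -
      have "8 * (real K + 1) / (\<delta> * \<epsilon>) \<le> T" "0 < T" by (simp_all add: T_def)
      thus ?thesis using \<delta>(1) \<epsilon> by (simp add: field_simps)
    qed
    finally have "\<delta> * (\<Sum>j\<le>K. \<bar>d j\<bar>) \<le> \<delta> * (\<bar>\<Sum>j\<le>K. d j\<bar> + \<epsilon> / 4)"
      by (simp add: algebra_simps)
    hence "(\<Sum>j\<le>K. \<bar>d j\<bar>) \<le> \<bar>\<Sum>j\<le>K. d j\<bar> + \<epsilon> / 4"
      using \<delta>(1) by simp
    moreover have "(\<Sum>j\<le>K. d j) = ?s t / t - ?s t' / t'"
      by (simp add: d_def sum_subtractf sum_divide_distrib)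
    hence "\<bar>\<Sum>j\<le>K. d j\<bar> < \<epsilon> / 2"
      using T1[of t] T1[of t'] pos unfolding dist_real_def by linarith
    moreover have "\<bar>d k\<bar> \<le> (\<Sum>j\<le>K. \<bar>d j\<bar>)"
      using k by (intro member_le_sum) auto
    ultimately show ?thesis using \<epsilon> unfolding d_def by linarith
  qed
  thus "\<exists>T. \<forall>t\<ge>T. \<forall>t'\<ge>T. \<bar>h k t / t - h k t' / t'\<bar> < \<epsilon>" by blast
qed

section \<open>The Markov property of the number of busy servers\<close>

text \<open>Tonelli on the product of the two laws. It does the work of conditioning on
  \<open>Y\<close>: an event may be evaluated with \<open>Y\<close> frozen at a constant and
  averaged afterwards.\<close>

lemma (in prob_space) indep_var_prob_eq:
  assumes ind: "indep_var N1 X N2 Y" and Q: "Measurable.pred (N1 \<Otimes>\<^sub>M N2) (\<lambda>w. Q (fst w) (snd w))"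
  shows "prob {\<omega> \<in> space M. Q (X \<omega>) (Y \<omega>)} = (\<integral>\<omega>'. prob {\<omega> \<in> space M. Q (X \<omega>) (Y \<omega>')} \<partial>M)"
proof -
  note rv = indep_var_rv1[OF ind] indep_var_rv2[OF ind]
  note [measurable] = rv
  have sec: "Measurable.pred N1 (\<lambda>x. Q x y)" if "y \<in> space N2" for y
    using measurable_compose[OF measurable_Pair[OF measurable_ident measurable_const[OF that]] Q]
    by simp
  interpret D1: prob_space "distr M N1 X" by (rule prob_space_distr) simp
  interpret D2: prob_space "distr M N2 Y" by (rule prob_space_distr) simp
  interpret P: pair_prob_space "distr M N1 X" "distr M N2 Y" ..
  let ?C = "{w \<in> space (N1 \<Otimes>\<^sub>M N2). Q (fst w) (snd w)}"
  have C[measurable]: "?C \<in> sets (N1 \<Otimes>\<^sub>M N2)"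
    using Q by (simp add: pred_def)
  have C': "?C \<in> sets (distr M N1 X \<Otimes>\<^sub>M distr M N2 Y)"
    using C by (simp cong: sets_pair_measure_cong)
  have fibre: "emeasure (distr M N1 X) ((\<lambda>x. (x, y)) -` ?C) = prob {\<omega> \<in> space M. Q (X \<omega>) y}"
    if y: "y \<in> space N2" for y
  proof -
    have "(\<lambda>x. (x, y)) -` ?C = {x \<in> space N1. Q x y}"
      using y by (auto simp: space_pair_measure)
    moreover have "{x \<in> space N1. Q x y} \<in> sets N1" using sec[OF y] by (simp add: pred_def)
    ultimately have "emeasure (distr M N1 X) ((\<lambda>x. (x, y)) -` ?C) =
        emeasure M (X -` {x \<in> space N1. Q x y} \<inter> space M)"
      by (simp add: emeasure_distr)
    also have "X -` {x \<in> space N1. Q x y} \<inter> space M = {\<omega> \<in> space M. Q (X \<omega>) y}"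
      using measurable_space[OF rv(1)] by auto
    finally show ?thesis by (simp add: emeasure_eq_measure)
  qed
  have meas: "(\<lambda>y. emeasure (distr M N1 X) ((\<lambda>x. (x, y)) -` ?C)) \<in> borel_measurable N2"
    using P.measurable_emeasure_Pair2[OF C'] by simp
  have "(\<lambda>\<omega>'. ennreal (prob {\<omega> \<in> space M. Q (X \<omega>) (Y \<omega>')})) \<in> borel_measurable M"
    using measurable_compose[OF rv(2) meas] fibre measurable_space[OF rv(2)]
    by (subst measurable_cong[where g="\<lambda>\<omega>'. emeasure (distr M N1 X) ((\<lambda>x. (x, Y \<omega>')) -` ?C)"]) auto
  from borel_measurable_enn2real[OF this]
  have m: "(\<lambda>\<omega>'. prob {\<omega> \<in> space M. Q (X \<omega>) (Y \<omega>')}) \<in> borel_measurable M" by simp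
  have "ennreal (prob {\<omega> \<in> space M. Q (X \<omega>) (Y \<omega>)}) = emeasure M {\<omega> \<in> space M. Q (X \<omega>) (Y \<omega>)}"
    by (simp add: emeasure_eq_measure)
  also have "\<dots> = emeasure M ((\<lambda>\<omega>. (X \<omega>, Y \<omega>)) -` ?C \<inter> space M)"
    using measurable_space[OF rv(1)] measurable_space[OF rv(2)]
    by (intro arg_cong[where f="emeasure M"]) (auto simp: space_pair_measure)
  also have "\<dots> = emeasure (distr M (N1 \<Otimes>\<^sub>M N2) (\<lambda>\<omega>. (X \<omega>, Y \<omega>))) ?C"
    by (subst emeasure_distr) auto
  also have "\<dots> = emeasure (distr M N1 X \<Otimes>\<^sub>M distr M N2 Y) ?C"
    using ind by (simp add: indep_var_distribution_eq)
  also have "\<dots> = (\<integral>\<^sup>+y. emeasure (distr M N1 X) ((\<lambda>x. (x, y)) -` ?C) \<partial>distr M N2 Y)"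
    by (rule P.emeasure_pair_measure_alt2[OF C'])
  also have "\<dots> = (\<integral>\<^sup>+\<omega>'. emeasure (distr M N1 X) ((\<lambda>x. (x, Y \<omega>')) -` ?C) \<partial>M)"
    using meas by (subst nn_integral_distr) auto
  also have "\<dots> = (\<integral>\<^sup>+\<omega>'. prob {\<omega> \<in> space M. Q (X \<omega>) (Y \<omega>')} \<partial>M)"
    using fibre measurable_space[OF rv(2)] by (intro nn_integral_cong) auto
  also have "\<dots> = ennreal (\<integral>\<omega>'. prob {\<omega> \<in> space M. Q (X \<omega>) (Y \<omega>')} \<partial>M)"
    using m by (intro nn_integral_eq_integral integrable_const_bound[where B=1]) auto
  finally show "prob {\<omega> \<in> space M. Q (X \<omega>) (Y \<omega>)} =
      (\<integral>\<omega>'. prob {\<omega> \<in> space M. Q (X \<omega>) (Y \<omega>')} \<partial>M)"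
    by (subst (asm) ennreal_inj) (auto intro: integral_nonneg)
qed

lemma (in prob_space) prob_eq_expectation:
  assumes "Measurable.pred M Q"
  shows "prob {\<omega> \<in> space M. Q \<omega>} = expectation (\<lambda>\<omega>. of_bool (Q \<omega>))"
proof -
  have "{\<omega> \<in> space M. Q \<omega>} \<in> events" using assms by (simp add: pred_def)
  hence "prob {\<omega> \<in> space M. Q \<omega>} = expectation (indicator {\<omega> \<in> space M. Q \<omega>})"
    by simp
  also have "\<dots> = expectation (\<lambda>\<omega>. of_bool (Q \<omega>))"
    by (intro Bochner_Integration.integral_cong) (auto simp: indicator_def)
  finally show ?thesis .
qed

lemma (in prob_space) integrable_of_bool:
  assumes "Measurable.pred M Q"
  shows "integrable M (\<lambda>\<omega>. of_bool (Q \<omega>) :: real)"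
  using assms by (intro integrable_const_bound[where B=1]) (auto simp: of_bool_def)

section \<open>Independent blocks of variables and memorylessness\<close>

context pricing_system
begin

abbreviation driver :: "nat + nat + nat \<Rightarrow> 'a \<Rightarrow> real" where
  "driver \<equiv> case_sum U (case_sum S V)"

abbreviation driver_index :: "(nat + nat + nat) set" where
  "driver_index \<equiv> {1..} <+> {1..} <+> {1..}"

abbreviation block :: "(nat + nat + nat) set \<Rightarrow> 'a \<Rightarrow> nat + nat + nat \<Rightarrow> real" where
  "block J \<omega> \<equiv> restrict (\<lambda>i. driver i \<omega>) J"

lemma indep_blocks:
  assumes "J \<inter> L = {}" "J \<subseteq> driver_index" "L \<subseteq> driver_index"
  shows "indep_var (PiM J (\<lambda>_. borel)) (block J) (PiM L (\<lambda>_. borel)) (block L)"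
  using indep_var_restrict[OF indep assms] .

lemma driver_measurable:
  assumes "i \<in> driver_index"
  shows "driver i \<in> borel_measurable M"
  using indep assms unfolding indep_vars_def2 by blast

lemma measurable_U: "1 \<le> n \<Longrightarrow> U n \<in> borel_measurable M"
  and measurable_S: "1 \<le> n \<Longrightarrow> S n \<in> borel_measurable M"
  and measurable_V: "1 \<le> n \<Longrightarrow> V n \<in> borel_measurable M"
  using driver_measurable[of "Inl n"] driver_measurable[of "Inr (Inl n)"]
    driver_measurable[of "Inr (Inr n)"] by auto

lemma expectation_U_eq:
  fixes g :: "real \<Rightarrow> real"
  assumes "1 \<le> n" and [measurable]: "g \<in> borel_measurable borel"
  shows "expectation (\<lambda>\<omega>. g (U n \<omega>)) = expectation (\<lambda>\<omega>. g (U 1 \<omega>))"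
proof -
  note [measurable] = measurable_U[OF assms(1)]
  have "expectation (\<lambda>\<omega>. g (U n \<omega>)) = (\<integral>x. g x \<partial>distr M borel (U n))"
    by (subst integral_distr) auto
  also have "\<dots> = (\<integral>x. g x \<partial>distr M borel (U 1))"
    by (simp only: U_distr[OF assms(1)])
  also have "\<dots> = expectation (\<lambda>\<omega>. g (U 1 \<omega>))"
    using measurable_U[of 1] by (subst integral_distr) auto
  finally show ?thesis .
qed

lemma prob_V_eq:
  assumes "1 \<le> n"
  shows "prob {\<omega> \<in> space M. x \<le> V n \<omega>} = prob {\<omega> \<in> space M. x \<le> V 1 \<omega>}"
proof -
  have "prob {\<omega> \<in> space M. x \<le> V n \<omega>} = measure (distr M borel (V n)) {x..}" if "1 \<le> n" for n
    using measurable_V[OF that] by (subst measure_distr) (auto intro!: arg_cong[where f=prob])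
  thus ?thesis using V_distr[OF assms] assms by simp
qed

lemma prob_S_gt: "1 \<le> m \<Longrightarrow> 0 \<le> a \<Longrightarrow> prob {\<omega> \<in> space M. a < S m \<omega>} = exp (- a * \<mu>)"
  using exponential_distributedD_gt[OF S_exponential[of m] _ rate_pos(2)] by simp

text \<open>Given U_1 = u, each job in service outlasts the interarrival time with probability exp(-
  \<mu> u), independently. This is the probability that, of \<open>y\<close> jobs, precisely a
  prescribed set of \<open>j\<close> survives.\<close>

definition survival :: "nat \<Rightarrow> nat \<Rightarrow> real" where
  "survival y j = expectation (\<lambda>\<omega>. exp (- \<mu> * U 1 \<omega>) ^ j * (1 - exp (- \<mu> * U 1 \<omega>)) ^ (y - j))"

text \<open>Memorylessness with deterministic ages \<open>a\<close> and a deterministic waiting time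
  \<open>u\<close>: each job contributes the probability of reaching its age times a factor that
  depends only on whether it is in \<open>d\<close>.\<close>

lemma prob_survivors_fixed:
  fixes a :: "nat \<Rightarrow> real"
  assumes b: "finite b" "b \<subseteq> {1..}" and d: "d \<subseteq> b" and a: "\<And>m. m \<in> b \<Longrightarrow> 0 \<le> a m" and u: "0 \<le> u"
  shows "prob {\<omega> \<in> space M. \<forall>m\<in>b. a m < S m \<omega> \<and> (a m + u < S m \<omega>) = (m \<in> d)} =
    (\<Prod>m\<in>b. exp (- a m * \<mu>)) * (exp (- \<mu> * u) ^ card d * (1 - exp (- \<mu> * u)) ^ (card b - card d))"
proof (cases "b = {}")
  case True
  thus ?thesis using d by (simp add: prob_space)
next
  case False
  \<comment> \<open>\<open>J m\<close> is the range of \<open>S m\<close> that the event allows, so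
    that the event is an intersection over independent variables.\<close>
  define J where "J m = (if m \<in> d then {a m + u<..} else {a m<..a m + u})" for m
  have J: "J m \<in> sets borel" for m by (simp add: J_def)
  let ?i = "\<lambda>m::nat. Inr (Inl m) :: nat + nat + nat"
  have "{\<omega> \<in> space M. \<forall>m\<in>b. a m < S m \<omega> \<and> (a m + u < S m \<omega>) = (m \<in> d)} =
      (\<Inter>i\<in>?i ` b. driver i -` (case i of Inl _ \<Rightarrow> UNIV | Inr (Inl m) \<Rightarrow> J m | Inr (Inr _) \<Rightarrow> UNIV) \<inter> space M)"
    using False u unfolding J_def by (auto split: if_splits)
  also have "prob \<dots> = (\<Prod>i\<in>?i ` b. prob (driver i -` (case i of Inl _ \<Rightarrow> UNIV | Inr (Inl m) \<Rightarrow> J m | Inr (Inr _) \<Rightarrow> UNIV) \<inter> space M))"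
    using False b J by (intro indep_varsD[OF indep]) auto
  also have "\<dots> = (\<Prod>m\<in>b. prob (S m -` J m \<inter> space M))"
    by (subst prod.reindex) (auto simp: inj_on_def)
  also have "\<dots> = (\<Prod>m\<in>b. exp (- a m * \<mu>) * (if m \<in> d then exp (- \<mu> * u) else 1 - exp (- \<mu> * u)))"
  proof (rule prod.cong)
    fix m assume m: "m \<in> b"
    hence m1: "1 \<le> m" using b by auto
    note [measurable] = measurable_S[OF m1]
    have gt: "prob {\<omega> \<in> space M. a m + u < S m \<omega>} = exp (- a m * \<mu>) * exp (- \<mu> * u)"
      using prob_S_gt[OF m1, of "a m + u"] a[OF m] u
      by (simp add: exp_add[symmetric] algebra_simps)
    show "prob (S m -` J m \<inter> space M) =
        exp (- a m * \<mu>) * (if m \<in> d then exp (- \<mu> * u) else 1 - exp (- \<mu> * u))"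
    proof (cases "m \<in> d")
      case True
      hence "S m -` J m \<inter> space M = {\<omega> \<in> space M. a m + u < S m \<omega>}" by (auto simp: J_def)
      thus ?thesis using gt True by simp
    next
      case False
      hence "S m -` J m \<inter> space M =
          {\<omega> \<in> space M. a m < S m \<omega>} - {\<omega> \<in> space M. a m + u < S m \<omega>}" by (auto simp: J_def)
      moreover have "prob ({\<omega> \<in> space M. a m < S m \<omega>} - {\<omega> \<in> space M. a m + u < S m \<omega>}) =
          prob {\<omega> \<in> space M. a m < S m \<omega>} - prob {\<omega> \<in> space M. a m + u < S m \<omega>}"
        using u by (intro finite_measure_Diff) auto
      ultimately show ?thesis
        using gt False prob_S_gt[OF m1 a[OF m]] by (simp add: algebra_simps)
    qed
  qed simp
  also have "\<dots> = (\<Prod>m\<in>b. exp (- a m * \<mu>)) *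
      (exp (- \<mu> * u) ^ card d * (1 - exp (- \<mu> * u)) ^ (card b - card d))"
  proof -
    have "b \<inter> {m. m \<in> d} = d" "b \<inter> - {m. m \<in> d} = b - d" using d by auto
    thus ?thesis
      using b d by (simp add: prod.distrib prod.If_cases card_Diff_subset finite_subset)
  qed
  finally show ?thesis .
qed

end

text \<open>Nonnegativity at every sample point keeps null sets out of the pathwise arguments. The
  general system is reduced to this one by truncation at 0.\<close>

locale nonneg_pricing_system = pricing_system +
  fixes K :: nat and p :: "nat \<Rightarrow> real"
  assumes U_ge0: "\<And>n \<omega>. 1 \<le> n \<Longrightarrow> 0 \<le> U n \<omega>"
begin

text \<open>The waiting time becomes random: it is independent of the service times, so averaging
  the fixed case over it turns the survival factor into \<open>survival\<close>.\<close>

lemma prob_survivors: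
  fixes a :: "nat \<Rightarrow> real"
  assumes b: "finite b" "b \<subseteq> {1..}" and d: "d \<subseteq> b" and a: "\<And>m. m \<in> b \<Longrightarrow> 0 \<le> a m" and l: "1 \<le> l"
  shows "prob {\<omega> \<in> space M. \<forall>m\<in>b. a m < S m \<omega> \<and> (a m + U l \<omega> < S m \<omega>) = (m \<in> d)} =
    survival (card b) (card d) * prob {\<omega> \<in> space M. \<forall>m\<in>b. a m < S m \<omega>}"
proof -
  let ?i = "\<lambda>m::nat. Inr (Inl m) :: nat + nat + nat"
  let ?J = "?i ` b" let ?L = "{Inl l} :: (nat + nat + nat) set"
  let ?Q = "\<lambda>x y. \<forall>m\<in>b. a m < x (?i m) \<and> (a m + y (Inl l) < x (?i m)) = (m \<in> d)"
  have ind: "indep_var (PiM ?J (\<lambda>_. borel)) (block ?J) (PiM ?L (\<lambda>_. borel)) (block ?L)"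
    using b l by (intro indep_blocks) auto
  have Q: "Measurable.pred (PiM ?J (\<lambda>_. borel) \<Otimes>\<^sub>M PiM ?L (\<lambda>_. borel)) (\<lambda>w. ?Q (fst w) (snd w))"
  proof (rule pred_intros_finite)
    fix m assume m: "m \<in> b"
    have [measurable]: "(\<lambda>w. fst w (?i m)) \<in>
        borel_measurable (PiM ?J (\<lambda>_. borel) \<Otimes>\<^sub>M PiM ?L (\<lambda>_. borel))"
      using m by (intro measurable_compose[OF measurable_fst measurable_component_singleton]) auto
    have [measurable]: "(\<lambda>w. snd w (Inl l)) \<in>
        borel_measurable (PiM ?J (\<lambda>_. borel) \<Otimes>\<^sub>M PiM ?L (\<lambda>_. borel))"
      by (intro measurable_compose[OF measurable_snd measurable_component_singleton]) auto
    show "Measurable.pred (PiM ?J (\<lambda>_. borel) \<Otimes>\<^sub>M PiM ?L (\<lambda>_. borel))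
        (\<lambda>w. a m < fst w (?i m) \<and> (a m + snd w (Inl l) < fst w (?i m)) = (m \<in> d))"
      by measurable
  qed (use b in simp)
  let ?g = "\<lambda>u. exp (- \<mu> * u) ^ card d * (1 - exp (- \<mu> * u)) ^ (card b - card d)"
  have "prob {\<omega> \<in> space M. \<forall>m\<in>b. a m < S m \<omega> \<and> (a m + U l \<omega> < S m \<omega>) = (m \<in> d)} =
      prob {\<omega> \<in> space M. ?Q (block ?J \<omega>) (block ?L \<omega>)}"
    by simp
  also have "\<dots> = (\<integral>\<omega>'. prob {\<omega> \<in> space M. ?Q (block ?J \<omega>) (block ?L \<omega>')} \<partial>M)"
    by (rule indep_var_prob_eq[OF ind Q])
  also have "\<dots> = (\<integral>\<omega>'. (\<Prod>m\<in>b. exp (- a m * \<mu>)) * ?g (U l \<omega>') \<partial>M)"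
  proof (rule Bochner_Integration.integral_cong)
    fix \<omega>' assume "\<omega>' \<in> space M"
    show "prob {\<omega> \<in> space M. ?Q (block ?J \<omega>) (block ?L \<omega>')} =
        (\<Prod>m\<in>b. exp (- a m * \<mu>)) * ?g (U l \<omega>')"
      using prob_survivors_fixed[OF b d a U_ge0[OF l, of \<omega>']] by simp
  qed simp
  also have "\<dots> = (\<Prod>m\<in>b. exp (- a m * \<mu>)) * expectation (\<lambda>\<omega>. ?g (U l \<omega>))" by simp
  also have "expectation (\<lambda>\<omega>. ?g (U l \<omega>)) = survival (card b) (card d)"
    unfolding survival_def by (rule expectation_U_eq[OF l]) simp
  \<comment> \<open>The fixed case with \<open>d = b\<close> and waiting time 0.\<close>
  also have "(\<Prod>m\<in>b. exp (- a m * \<mu>)) = prob {\<omega> \<in> space M. \<forall>m\<in>b. a m < S m \<omega>}"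
    using prob_survivors_fixed[OF b order_refl a order_refl]
    by (simp add: conj_absorb cong: ball_cong conj_cong)
  finally show ?thesis by simp
qed

abbreviation arr :: "nat \<Rightarrow> 'a \<Rightarrow> real" where
  "arr n \<omega> \<equiv> arrival_time (\<lambda>i. U i \<omega>) n"

abbreviation occ :: "nat \<Rightarrow> 'a \<Rightarrow> nat" where
  "occ n \<omega> \<equiv> busy K p (\<lambda>i. U i \<omega>) (\<lambda>i. S i \<omega>) (\<lambda>i. V i \<omega>) n"

abbreviation adm :: "nat \<Rightarrow> 'a \<Rightarrow> bool" where
  "adm n \<omega> \<equiv> admitted K p (\<lambda>i. U i \<omega>) (\<lambda>i. S i \<omega>) (\<lambda>i. V i \<omega>) n"

abbreviation present :: "nat \<Rightarrow> 'a \<Rightarrow> nat set" where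
  "present n \<omega> \<equiv> in_service K p (\<lambda>i. U i \<omega>) (\<lambda>i. S i \<omega>) (\<lambda>i. V i \<omega>) n"

lemma measurable_arr: "arr n \<in> borel_measurable M"
  by (intro measurable_arrival_time measurable_U)

lemma measurable_occ: "occ n \<in> measurable M (count_space UNIV)"
  by (intro measurable_busy measurable_U measurable_S measurable_V) auto

lemma measurable_present: "Measurable.pred M (\<lambda>\<omega>. present n \<omega> = b)"
  by (intro measurable_in_service measurable_U measurable_S measurable_V) auto

lemma arr_mono: "m \<le> n \<Longrightarrow> arr m \<omega> \<le> arr n \<omega>"
  by (rule arrival_time_mono) (auto intro: U_ge0)

text \<open>The core of the Markov property. By the override lemma, the past is an event
  \<open>H\<close> not involving the service times of \<open>b\<close>, together with the lower
  bounds A_n - A_m on them. Once \<open>H\<close> and the ages are frozen,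
  \<open>prob_survivors\<close> applies, and its factor depends on \<open>card b\<close> and
  \<open>card d\<close> alone.\<close>

lemma prob_present_survivors:
  assumes b: "b \<subseteq> {1..n}" and d: "d \<subseteq> b"
  shows "prob {\<omega> \<in> space M. present n \<omega> = b \<and> arr n \<omega> \<le> t \<and>
      {m \<in> present n \<omega>. arr (Suc n) \<omega> < arr m \<omega> + S m \<omega>} = d} =
    survival (card b) (card d) * prob {\<omega> \<in> space M. present n \<omega> = b \<and> arr n \<omega> \<le> t}"
proof -
  let ?i = "\<lambda>m::nat. Inr (Inl m) :: nat + nat + nat"
  \<comment> \<open>\<open>?J\<close> holds what stays random, the next interarrival time and the
    service times of \<open>b\<close>; \<open>L\<close> holds the rest of the history up to job
    \<open>n\<close> and is frozen.\<close>
  let ?J = "insert (Inl (Suc n)) (?i ` b)"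
  define L where "L = {1..n} <+> ({1..n} - b) <+> {1..n}"
  let ?M1 = "PiM ?J (\<lambda>_. borel) :: (nat + nat + nat \<Rightarrow> real) measure"
  let ?M2 = "PiM L (\<lambda>_. borel) :: (nat + nat + nat \<Rightarrow> real) measure"
  define A where "A y m = arrival_time (\<lambda>i. y (Inl i)) m" for y :: "nat + nat + nat \<Rightarrow> real" and m
  define s' where "s' y m = (if m \<in> b then A y n - A y m + 1 else y (?i m))" for y m
  define H where "H y \<longleftrightarrow> in_service K p (\<lambda>i. y (Inl i)) (s' y) (\<lambda>i. y (Inr (Inr i))) n = b \<and> A y n \<le> t" for y
  \<comment> \<open>\<open>Q\<close> prescribes the survivors and \<open>Q'\<close> does not. For
    each frozen \<open>y\<close> their probabilities differ by the factor \<open>survival\<close>,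
    so the integrals do too.\<close>
  define Q where "Q x y \<longleftrightarrow> H y \<and> (\<forall>m\<in>b. A y n - A y m < x (?i m) \<and>
      (A y n - A y m + x (Inl (Suc n)) < x (?i m)) = (m \<in> d))" for x y :: "nat + nat + nat \<Rightarrow> real"
  define Q' where "Q' x y \<longleftrightarrow> H y \<and> (\<forall>m\<in>b. A y n - A y m < x (?i m))" for x y :: "nat + nat + nat \<Rightarrow> real"
  have fin: "finite b" using b finite_subset by blast
  have b1: "b \<subseteq> {1..}" using b by auto
  have ind: "indep_var ?M1 (block ?J) ?M2 (block L)"
    using b by (intro indep_blocks) (auto simp: L_def)
  have A: "A (block L \<omega>) m = arr m \<omega>" if "m \<le> n" for m \<omega>
    unfolding A_def arrival_time_def using that by (intro sum.cong) (auto simp: L_def)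
  have A_meas: "(\<lambda>y. A y m) \<in> borel_measurable ?M2" if "m \<le> n" for m
    unfolding A_def using that
    by (intro measurable_arrival_time measurable_component_singleton) (auto simp: L_def)
  have H_meas: "Measurable.pred ?M2 H"
  proof -
    have [measurable]: "Measurable.pred ?M2
        (\<lambda>y. in_service K p (\<lambda>i. y (Inl i)) (\<lambda>i. s' y i) (\<lambda>i. y (Inr (Inr i))) n = b)"
    proof (intro measurable_in_service measurable_component_singleton)
      fix i assume i: "1 \<le> i" "i \<le> n"
      show "(\<lambda>y. s' y i) \<in> borel_measurable ?M2"
      proof (cases "i \<in> b")
        case True
        note [measurable] = A_meas[OF i(2)] A_meas[OF order_refl]
        have "(\<lambda>y. A y n - A y i + 1) \<in> borel_measurable ?M2" by measurable
        thus ?thesis unfolding s'_def using True by simp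
      next
        case False
        thus ?thesis unfolding s'_def using i by (auto intro!: measurable_component_singleton simp: L_def)
      qed
    qed (auto simp: L_def)
    note [measurable] = A_meas[OF order_refl]
    show ?thesis unfolding H_def by measurable
  qed
  have Q_meas: "Measurable.pred (?M1 \<Otimes>\<^sub>M ?M2) (\<lambda>w. Q (fst w) (snd w))"
    and Q'_meas: "Measurable.pred (?M1 \<Otimes>\<^sub>M ?M2) (\<lambda>w. Q' (fst w) (snd w))"
  proof -
    have H': "Measurable.pred (?M1 \<Otimes>\<^sub>M ?M2) (\<lambda>w. H (snd w))"
      by (rule measurable_compose[OF measurable_snd H_meas])
    have *: "(\<lambda>w. fst w (?i m)) \<in> borel_measurable (?M1 \<Otimes>\<^sub>M ?M2)"
      "(\<lambda>w. A (snd w) n) \<in> borel_measurable (?M1 \<Otimes>\<^sub>M ?M2)"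
      "(\<lambda>w. A (snd w) m) \<in> borel_measurable (?M1 \<Otimes>\<^sub>M ?M2)"
      "(\<lambda>w. fst w (Inl (Suc n))) \<in> borel_measurable (?M1 \<Otimes>\<^sub>M ?M2)"
      if m: "m \<in> b" for m
    proof -
      have "m \<le> n" using m b by auto
      show "(\<lambda>w. A (snd w) n) \<in> borel_measurable (?M1 \<Otimes>\<^sub>M ?M2)"
        by (rule measurable_compose[OF measurable_snd A_meas[OF order_refl]])
      show "(\<lambda>w. A (snd w) m) \<in> borel_measurable (?M1 \<Otimes>\<^sub>M ?M2)"
        by (rule measurable_compose[OF measurable_snd A_meas[OF \<open>m \<le> n\<close>]])
      show "(\<lambda>w. fst w (?i m)) \<in> borel_measurable (?M1 \<Otimes>\<^sub>M ?M2)"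
        "(\<lambda>w. fst w (Inl (Suc n))) \<in> borel_measurable (?M1 \<Otimes>\<^sub>M ?M2)"
        using m by (auto intro!: measurable_compose[OF measurable_fst measurable_component_singleton])
    qed
    show "Measurable.pred (?M1 \<Otimes>\<^sub>M ?M2) (\<lambda>w. Q (fst w) (snd w))"
      unfolding Q_def
    proof (rule pred_intros_logic(3)[OF H' pred_intros_finite(3)[OF fin]])
      fix m assume m: "m \<in> b"
      note [measurable] = *[OF m]
      show "Measurable.pred (?M1 \<Otimes>\<^sub>M ?M2) (\<lambda>w. A (snd w) n - A (snd w) m < fst w (?i m) \<and>
        (A (snd w) n - A (snd w) m + fst w (Inl (Suc n)) < fst w (?i m)) = (m \<in> d))"
        by measurable
    qed
    show "Measurable.pred (?M1 \<Otimes>\<^sub>M ?M2) (\<lambda>w. Q' (fst w) (snd w))"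
      unfolding Q'_def
    proof (rule pred_intros_logic(3)[OF H' pred_intros_finite(3)[OF fin]])
      fix m assume m: "m \<in> b"
      note [measurable] = *[OF m]
      show "Measurable.pred (?M1 \<Otimes>\<^sub>M ?M2) (\<lambda>w. A (snd w) n - A (snd w) m < fst w (?i m))"
        by measurable
    qed
  qed
  have present_iff: "present n \<omega> = b \<and> arr n \<omega> \<le> t \<longleftrightarrow>
      H (block L \<omega>) \<and> (\<forall>m\<in>b. arr n \<omega> - arr m \<omega> < S m \<omega>)" for \<omega>
  proof -
    have "present n \<omega> = b \<longleftrightarrow>
      in_service K p (\<lambda>i. U i \<omega>) (\<lambda>m. if m \<in> b then arr n \<omega> - arr m \<omega> + 1 else S m \<omega>) (\<lambda>i. V i \<omega>) n = b \<and>
        (\<forall>m\<in>b. arr n \<omega> - arr m \<omega> < S m \<omega>)"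
      by (rule in_service_iff_override) (use U_ge0 b in auto)
    also have "in_service K p (\<lambda>i. U i \<omega>) (\<lambda>m. if m \<in> b then arr n \<omega> - arr m \<omega> + 1 else S m \<omega>) (\<lambda>i. V i \<omega>) n =
        in_service K p (\<lambda>i. block L \<omega> (Inl i)) (s' (block L \<omega>)) (\<lambda>i. block L \<omega> (Inr (Inr i))) n"
    proof (rule in_service_cong)
      fix m l assume ml: "1 \<le> m" "m \<le> l" "l \<le> n"
      have "arrival_time (\<lambda>i. block L \<omega> (Inl i)) l = arr l \<omega>"
        "arrival_time (\<lambda>i. block L \<omega> (Inl i)) m = arr m \<omega>"
        using A[of l \<omega>] A[of m \<omega>] ml unfolding A_def by auto
      moreover have "s' (block L \<omega>) m = (if m \<in> b then arr n \<omega> - arr m \<omega> + 1 else S m \<omega>)"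
        using A[of n \<omega>] A[of m \<omega>] ml unfolding s'_def by (auto simp: L_def)
      ultimately show "arr l \<omega> < arr m \<omega> + (if m \<in> b then arr n \<omega> - arr m \<omega> + 1 else S m \<omega>) \<longleftrightarrow>
          arrival_time (\<lambda>i. block L \<omega> (Inl i)) l
            < arrival_time (\<lambda>i. block L \<omega> (Inl i)) m + s' (block L \<omega>) m"
        by simp
    qed (auto simp: L_def)
    finally show ?thesis unfolding H_def by (auto simp: A)
  qed
  have "prob {\<omega> \<in> space M. present n \<omega> = b \<and> arr n \<omega> \<le> t \<and>
      {m \<in> present n \<omega>. arr (Suc n) \<omega> < arr m \<omega> + S m \<omega>} = d} =
      prob {\<omega> \<in> space M. Q (block ?J \<omega>) (block L \<omega>)}"
  proof (intro arg_cong[where f=prob] Collect_cong conj_cong refl)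
    fix \<omega>
    have "present n \<omega> = b \<and> arr n \<omega> \<le> t \<and>
          {m \<in> present n \<omega>. arr (Suc n) \<omega> < arr m \<omega> + S m \<omega>} = d \<longleftrightarrow>
        (present n \<omega> = b \<and> arr n \<omega> \<le> t) \<and>
          (\<forall>m\<in>b. (arr n \<omega> - arr m \<omega> + U (Suc n) \<omega> < S m \<omega>) = (m \<in> d))"
      using d by (auto simp: arrival_time_Suc algebra_simps)
    also have "\<dots> \<longleftrightarrow> Q (block ?J \<omega>) (block L \<omega>)"
      unfolding present_iff Q_def using b by (auto simp: A subset_iff)
    finally show "present n \<omega> = b \<and> arr n \<omega> \<le> t \<and>
        {m \<in> present n \<omega>. arr (Suc n) \<omega> < arr m \<omega> + S m \<omega>} = d \<longleftrightarrow>
      Q (block ?J \<omega>) (block L \<omega>)" .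
  qed
  also have "\<dots> = (\<integral>\<omega>'. prob {\<omega> \<in> space M. Q (block ?J \<omega>) (block L \<omega>')} \<partial>M)"
    by (rule indep_var_prob_eq[OF ind Q_meas])
  also have "\<dots> = (\<integral>\<omega>'. survival (card b) (card d) *
      prob {\<omega> \<in> space M. Q' (block ?J \<omega>) (block L \<omega>')} \<partial>M)"
  proof (rule Bochner_Integration.integral_cong)
    fix \<omega>' assume "\<omega>' \<in> space M"
    define a where "a m = arr n \<omega>' - arr m \<omega>'" for m
    have a: "A (block L \<omega>') n - A (block L \<omega>') m = a m" if "m \<in> b" for m
      using that b by (subst (1 2) A) (auto simp: a_def)
    show "prob {\<omega> \<in> space M. Q (block ?J \<omega>) (block L \<omega>')} = survival (card b) (card d) *
      prob {\<omega> \<in> space M. Q' (block ?J \<omega>) (block L \<omega>')}"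
    proof (cases "H (block L \<omega>')")
      case True
      have "0 \<le> a m" if "m \<in> b" for m
        using that b arr_mono[of m n \<omega>'] by (auto simp: a_def)
      from prob_survivors[OF fin b1 d this, where l = "Suc n"]
      show ?thesis unfolding Q_def Q'_def using True by (simp add: a cong: ball_cong)
    qed (simp add: Q_def Q'_def)
  qed simp
  also have "\<dots> = survival (card b) (card d) * prob {\<omega> \<in> space M. Q' (block ?J \<omega>) (block L \<omega>)}"
    unfolding indep_var_prob_eq[OF ind Q'_meas] by (rule integral_mult_right_zero)
  also have "prob {\<omega> \<in> space M. Q' (block ?J \<omega>) (block L \<omega>)} =
      prob {\<omega> \<in> space M. present n \<omega> = b \<and> arr n \<omega> \<le> t}"
    unfolding present_iff Q'_def using b
    by (intro arg_cong[where f=prob]) (auto simp: A subset_iff)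
  finally show ?thesis .
qed

section \<open>Renewal estimates\<close>

text \<open>The step behind Wald's identity: N_t + 1 > n holds precisely when A_n <= t, which
  depends on the first \<open>n\<close> interarrival times only.\<close>

lemma expectation_U_arr:
  fixes g :: "real \<Rightarrow> real"
  assumes g: "g \<in> borel_measurable borel" and int: "integrable M (\<lambda>\<omega>. g (U (Suc n) \<omega>))"
  shows "expectation (\<lambda>\<omega>. g (U (Suc n) \<omega>) * of_bool (arr n \<omega> \<le> t)) =
      expectation (\<lambda>\<omega>. g (U 1 \<omega>)) * prob {\<omega> \<in> space M. arr n \<omega> \<le> t}"
    and "integrable M (\<lambda>\<omega>. g (U (Suc n) \<omega>) * of_bool (arr n \<omega> \<le> t))"
proof -
  let ?J = "{Inl (Suc n)} :: (nat + nat + nat) set"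
  define L :: "(nat + nat + nat) set" where "L = Inl ` {1..n}"
  have ind: "indep_var (PiM ?J (\<lambda>_. borel)) (block ?J) (PiM L (\<lambda>_. borel)) (block L)"
    by (intro indep_blocks) (auto simp: L_def)
  let ?f = "\<lambda>y. of_bool (arrival_time (\<lambda>i. y (Inl i)) n \<le> t) :: real"
  have "(\<lambda>y. arrival_time (\<lambda>i. y (Inl i)) n) \<in> borel_measurable (PiM L (\<lambda>_. borel))"
    by (intro measurable_arrival_time measurable_component_singleton) (auto simp: L_def)
  hence f: "?f \<in> borel_measurable (PiM L (\<lambda>_. borel))" by simp
  have "(\<lambda>x. g (x (Inl (Suc n)))) \<in> borel_measurable (PiM ?J (\<lambda>_. borel))"
    by (rule measurable_compose[OF measurable_component_singleton[of _ _ "\<lambda>_. borel"] g]) simp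
  from indep_var_compose[OF ind this f]
  have "indep_var borel ((\<lambda>x. g (x (Inl (Suc n)))) \<circ> block ?J) borel (?f \<circ> block L)" .
  also have "(\<lambda>x. g (x (Inl (Suc n)))) \<circ> block ?J = (\<lambda>\<omega>. g (U (Suc n) \<omega>))"
    by auto
  also have "?f \<circ> block L = (\<lambda>\<omega>. of_bool (arr n \<omega> \<le> t))"
  proof
    fix \<omega>
    have "arrival_time (\<lambda>i. block L \<omega> (Inl i)) n = arr n \<omega>"
      unfolding arrival_time_def by (intro sum.cong) (auto simp: L_def)
    thus "(?f \<circ> block L) \<omega> = of_bool (arr n \<omega> \<le> t)" by simp
  qed
  finally have iv: "indep_var borel (\<lambda>\<omega>. g (U (Suc n) \<omega>)) borel (\<lambda>\<omega>. of_bool (arr n \<omega> \<le> t) :: real)" .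
  have pr: "Measurable.pred M (\<lambda>\<omega>. arr n \<omega> \<le> t)"
    using measurable_arr[of n] by simp
  show "expectation (\<lambda>\<omega>. g (U (Suc n) \<omega>) * of_bool (arr n \<omega> \<le> t)) =
      expectation (\<lambda>\<omega>. g (U 1 \<omega>)) * prob {\<omega> \<in> space M. arr n \<omega> \<le> t}"
    using indep_var_lebesgue_integral[OF iv int integrable_of_bool[OF pr]]
      expectation_U_eq[OF _ g, of "Suc n"] prob_eq_expectation[OF pr] by simp
  show "integrable M (\<lambda>\<omega>. g (U (Suc n) \<omega>) * of_bool (arr n \<omega> \<le> t))"
    by (rule indep_var_integrable[OF iv int integrable_of_bool[OF pr]])
qed

lemma integrable_U: "1 \<le> n \<Longrightarrow> integrable M (U n)"
proof -
  assume n: "1 \<le> n"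
  have "integrable (distr M borel (U n)) (\<lambda>x. x)"
    using U_mean(1) measurable_U[of 1] unfolding U_distr[OF n]
    by (subst integrable_distr_eq) auto
  thus ?thesis using measurable_U[OF n] by (subst (asm) integrable_distr_eq) auto
qed

lemma prob_U_pos: "\<not> (AE \<omega> in M. U 1 \<omega> = 0)"
proof
  assume "AE \<omega> in M. U 1 \<omega> = 0"
  hence "expectation (U 1) = expectation (\<lambda>_. 0)"
    using measurable_U[of 1] by (intro integral_cong_AE) auto
  thus False using U_mean(2) rate_pos by simp
qed

text \<open>With only a finite mean, the interarrival time that crosses t admits no uniform bound. A
  cap \<open>c\<close> bounds the overshoot and is enlarged only at the end, before t is
  chosen.\<close>

definition capped_mean :: "real \<Rightarrow> real" where
  "capped_mean c = expectation (\<lambda>\<omega>. min (U 1 \<omega>) c)"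

lemma integrable_capped: "1 \<le> n \<Longrightarrow> 0 \<le> c \<Longrightarrow> integrable M (\<lambda>\<omega>. min (U n \<omega>) c)"
  using measurable_U[of n] U_ge0[of n]
  by (intro integrable_const_bound[where B=c]) (auto simp: min_def)

lemma capped_mean_pos: "0 < c \<Longrightarrow> 0 < capped_mean c"
proof -
  assume c: "0 < c"
  have "capped_mean c \<noteq> 0"
  proof
    assume "capped_mean c = 0"
    hence "AE \<omega> in M. min (U 1 \<omega>) c = 0"
      using integral_nonneg_eq_0_iff_AE[OF integrable_capped[of 1 c]] c U_ge0[of 1]
      by (auto simp: capped_mean_def)
    hence "AE \<omega> in M. U 1 \<omega> = 0" using c by (elim AE_mp) (auto simp: min_def split: if_splits)
    thus False using prob_U_pos by simp
  qed
  moreover have "0 \<le> capped_mean c"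
    unfolding capped_mean_def using U_ge0 c by (intro Bochner_Integration.integral_nonneg) auto
  ultimately show ?thesis by simp
qed

lemma capped_mean_tendsto: "(\<lambda>n. capped_mean (real n)) \<longlonglongrightarrow> expectation (U 1)"
  unfolding capped_mean_def
proof (rule integral_dominated_convergence[where w="U 1"])
  show "AE \<omega> in M. (\<lambda>i. min (U 1 \<omega>) (real i)) \<longlonglongrightarrow> U 1 \<omega>"
  proof (rule AE_I2)
    fix \<omega>
    have "eventually (\<lambda>i. min (U 1 \<omega>) (real i) = U 1 \<omega>) sequentially"
      using eventually_ge_at_top[of "nat \<lceil>U 1 \<omega>\<rceil>"]
      by eventually_elim (auto simp: min_def)
    thus "(\<lambda>i. min (U 1 \<omega>) (real i)) \<longlonglongrightarrow> U 1 \<omega>" by (rule tendsto_eventually)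
  qed
  have [measurable]: "U 1 \<in> borel_measurable M" by (rule measurable_U) simp
  show "U 1 \<in> borel_measurable M" "(\<lambda>\<omega>. min (U 1 \<omega>) (real n)) \<in> borel_measurable M" for n
    by measurable
  show "AE \<omega> in M. norm (min (U 1 \<omega>) (real n)) \<le> U 1 \<omega>" for n
  proof (rule AE_I2)
    fix \<omega>
    have "0 \<le> U 1 \<omega>" by (rule U_ge0) simp
    thus "norm (min (U 1 \<omega>) (real n)) \<le> U 1 \<omega>" by simp
  qed
qed (rule U_mean(1))

text \<open>
  Wald's identity for \<open>N\<^sub>t + 1\<close> with increments capped at \<open>c\<close>: the capped increments overshoot \<open>t\<close>
  by at most \<open>c\<close>.
\<close>

lemma capped_mean_mult_sum_le:
  assumes t: "0 \<le> t" and c: "0 \<le> c"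
  shows "capped_mean c * (\<Sum>n<N. prob {\<omega> \<in> space M. arr n \<omega> \<le> t}) \<le> t + c"
proof -
  \<comment> \<open>The minimum with A_N makes the induction work: while A_N <= t the sum is at most
    A_N, so the next increment cannot lead beyond t + c.\<close>
  have path: "(\<Sum>n<N. min (U (Suc n) \<omega>) c * of_bool (arr n \<omega> \<le> t)) \<le> min (arr N \<omega>) (t + c)" for \<omega>
  proof (induction N)
    case 0
    show ?case using t c by (simp add: arrival_time_def)
  next
    case (Suc N)
    show ?case using Suc U_ge0[of "Suc N" \<omega>]
      by (cases "arr N \<omega> \<le> t") (auto simp: arrival_time_Suc)
  qed
  have int: "integrable M (\<lambda>\<omega>. min (U (Suc n) \<omega>) c * of_bool (arr n \<omega> \<le> t))" for n
    using integrable_capped[of "Suc n" c] c by (intro expectation_U_arr(2)[of "\<lambda>x. min x c"]) auto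
  have "capped_mean c * (\<Sum>n<N. prob {\<omega> \<in> space M. arr n \<omega> \<le> t}) =
      (\<Sum>n<N. expectation (\<lambda>\<omega>. min (U (Suc n) \<omega>) c * of_bool (arr n \<omega> \<le> t)))"
    unfolding sum_distrib_left capped_mean_def
    using expectation_U_arr(1)[of "\<lambda>x. min x c"] integrable_capped c by (intro sum.cong) auto
  also have "\<dots> = expectation (\<lambda>\<omega>. \<Sum>n<N. min (U (Suc n) \<omega>) c * of_bool (arr n \<omega> \<le> t))"
    using int by (subst Bochner_Integration.integral_sum) auto
  also have "\<dots> \<le> expectation (\<lambda>\<omega>. t + c)"
  proof (rule integral_mono)
    show "(\<Sum>n<N. min (U (Suc n) \<omega>) c * of_bool (arr n \<omega> \<le> t)) \<le> t + c" for \<omega>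
      using path[of \<omega>] by simp
  qed (auto intro!: Bochner_Integration.integrable_sum[OF int] simp del: sum_mult_of_bool_eq)
  finally show ?thesis by (simp add: prob_space)
qed

text \<open>Finiteness of the renewal function, from the capped Wald bound; the cap 1 is
  arbitrary.\<close>

lemma summable_prob_arr:
  assumes t: "0 \<le> t"
  shows "summable (\<lambda>n. prob {\<omega> \<in> space M. arr n \<omega> \<le> t})"
proof (rule summableI_nonneg_bounded)
  fix N
  have "0 < capped_mean 1" by (rule capped_mean_pos) simp
  thus "(\<Sum>n<N. prob {\<omega> \<in> space M. arr n \<omega> \<le> t}) \<le> (t + 1) / capped_mean 1"
    using capped_mean_mult_sum_le[OF t, of 1 N] by (simp add: field_simps)
qed simp

text \<open>The renewal function m(t), written as the sum of the tails P(N_t >= n) over n >=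
  1.\<close>

definition mean_arrivals :: "real \<Rightarrow> real" where
  "mean_arrivals t = (\<Sum>n. prob {\<omega> \<in> space M. arr (Suc n) \<omega> \<le> t})"

lemma suminf_prob_arr:
  assumes t: "0 \<le> t"
  shows "(\<Sum>n. prob {\<omega> \<in> space M. arr n \<omega> \<le> t}) = 1 + mean_arrivals t"
proof -
  have "prob {\<omega> \<in> space M. arr 0 \<omega> \<le> t} = 1" using t by (simp add: arrival_time_def prob_space)
  thus ?thesis
    using suminf_split_head[OF summable_prob_arr[OF t]] unfolding mean_arrivals_def by simp
qed

lemma mean_arrivals_upper:
  assumes t: "0 \<le> t" and c: "0 < c"
  shows "1 + mean_arrivals t \<le> (t + c) / capped_mean c"
proof -
  have pos: "0 < capped_mean c" by (rule capped_mean_pos[OF c])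
  have "(\<Sum>n. prob {\<omega> \<in> space M. arr n \<omega> \<le> t}) \<le> (t + c) / capped_mean c"
  proof (rule suminf_le_const[OF summable_prob_arr[OF t]])
    fix N
    show "(\<Sum>n<N. prob {\<omega> \<in> space M. arr n \<omega> \<le> t}) \<le> (t + c) / capped_mean c"
      using capped_mean_mult_sum_le[OF t, of c N] c pos by (simp add: field_simps)
  qed
  thus ?thesis by (simp add: suminf_prob_arr[OF t])
qed

text \<open>Wald's identity without a cap: the interarrival times up to and including the one that
  crosses t add up to at least t. The sum is cut at \<open>N\<close>, which costs the event A_N <=
  t, whose probability tends to 0.\<close>

lemma mean_arrivals_lower:
  assumes t: "0 \<le> t"
  shows "t \<le> expectation (U 1) * (1 + mean_arrivals t)"
proof -
  let ?P = "\<lambda>n. prob {\<omega> \<in> space M. arr n \<omega> \<le> t}"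
  note [measurable] = measurable_arr
  have le: "t * (1 - ?P N) \<le> expectation (U 1) * (1 + mean_arrivals t)" for N
  proof -
    have path: "min t (arr N \<omega>) \<le> (\<Sum>n<N. U (Suc n) \<omega> * of_bool (arr n \<omega> \<le> t))" for \<omega>
    proof (induction N)
      case 0
      show ?case using t by (simp add: arrival_time_def)
    next
      case (Suc N)
      show ?case using Suc U_ge0[of "Suc N" \<omega>]
        by (cases "arr N \<omega> \<le> t") (auto simp: arrival_time_Suc)
    qed
    have int: "integrable M (\<lambda>\<omega>. U (Suc n) \<omega> * of_bool (arr n \<omega> \<le> t))" for n
      using integrable_U[of "Suc n"] by (intro expectation_U_arr(2)[of "\<lambda>x. x"]) auto
    have pr: "Measurable.pred M (\<lambda>\<omega>. arr N \<omega> \<le> t)" by measurable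
    have "t * (1 - ?P N) = expectation (\<lambda>\<omega>. t * (1 - of_bool (arr N \<omega> \<le> t)))"
      using integrable_of_bool[OF pr] by (simp add: prob_eq_expectation[OF pr] prob_space)
    also have "\<dots> \<le> expectation (\<lambda>\<omega>. \<Sum>n<N. U (Suc n) \<omega> * of_bool (arr n \<omega> \<le> t))"
    proof (rule integral_mono)
      fix \<omega>
      have "0 \<le> (\<Sum>n<N. U (Suc n) \<omega> * of_bool (arr n \<omega> \<le> t))"
        using U_ge0 by (intro sum_nonneg) auto
      thus "t * (1 - of_bool (arr N \<omega> \<le> t)) \<le> (\<Sum>n<N. U (Suc n) \<omega> * of_bool (arr n \<omega> \<le> t))"
        using path[of \<omega>] by (cases "arr N \<omega> \<le> t") auto
    qed (use integrable_of_bool[OF pr] in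
        \<open>auto intro!: Bochner_Integration.integrable_sum[OF int] simp del: sum_mult_of_bool_eq\<close>)
    also have "\<dots> = (\<Sum>n<N. expectation (U 1) * ?P n)"
      using int expectation_U_arr(1)[of "\<lambda>x. x"] integrable_U
      by (subst Bochner_Integration.integral_sum) auto
    also have "\<dots> = expectation (U 1) * (\<Sum>n<N. ?P n)" by (simp add: sum_distrib_left)
    also have "\<dots> \<le> expectation (U 1) * (1 + mean_arrivals t)"
      unfolding suminf_prob_arr[OF t, symmetric] using U_mean(2) rate_pos
      by (intro mult_left_mono sum_le_suminf summable_prob_arr t) auto
    finally show ?thesis .
  qed
  have "(\<lambda>N. t * (1 - ?P N)) \<longlonglongrightarrow> t * (1 - 0)"
    by (intro tendsto_intros summable_LIMSEQ_zero summable_prob_arr t)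
  from LIMSEQ_le_const2[OF this] le show ?thesis by auto
qed

text \<open>The elementary renewal theorem. For a fixed cap, the upper bound divided by t tends to
  the reciprocal of the capped mean, and this is close to 1 / E U_1 for a large cap.\<close>

lemma mean_arrivals_tendsto:
  "((\<lambda>t. mean_arrivals t / t) \<longlongrightarrow> 1 / expectation (U 1)) at_top"
proof (rule tendstoI)
  let ?E = "expectation (U 1)"
  have E: "0 < ?E" using U_mean(2) rate_pos by simp
  fix e :: real assume e: "0 < e"
  have "(\<lambda>n. 1 / capped_mean (real n)) \<longlonglongrightarrow> 1 / ?E"
    using E by (intro tendsto_intros capped_mean_tendsto) auto
  hence "eventually (\<lambda>n. dist (1 / capped_mean (real n)) (1 / ?E) < e / 2 \<and> 1 \<le> n) sequentially"
    using tendstoD[of _ "1 / ?E" sequentially "e / 2"] e eventually_ge_at_top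
    by (intro eventually_conj) auto
  then obtain n where n: "dist (1 / capped_mean (real n)) (1 / ?E) < e / 2" "1 \<le> n"
    using eventually_happens[of _ sequentially] by auto
  define c where "c = real n"
  have c: "0 < c" "0 < capped_mean c" using n(2) capped_mean_pos by (auto simp: c_def)
  have div_t: "((\<lambda>t. a / t) \<longlongrightarrow> 0) at_top" for a :: real
    by (rule tendsto_divide_0[OF tendsto_const filterlim_at_top_imp_at_infinity[OF filterlim_ident]])
  have "eventually (\<lambda>t. 0 < t \<and> 1 / t < e \<and> c / capped_mean c / t < e / 2) at_top"
    using e order_tendstoD(2)[OF div_t, of e 1] order_tendstoD(2)[OF div_t, of "e / 2" "c / capped_mean c"]
    by (intro eventually_conj eventually_gt_at_top) auto
  thus "eventually (\<lambda>t. dist (mean_arrivals t / t) (1 / ?E) < e) at_top"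
  proof eventually_elim
    case (elim t)
    have "mean_arrivals t / t \<le> (1 + mean_arrivals t) / t" using elim by (simp add: divide_right_mono)
    also have "\<dots> \<le> (t + c) / capped_mean c / t"
      using mean_arrivals_upper[of t c] c elim by (intro divide_right_mono) auto
    also have "\<dots> = 1 / capped_mean c + c / capped_mean c / t"
      using elim c by (simp add: field_simps)
    also have "\<dots> < 1 / ?E + e"
      using n(1) elim unfolding c_def dist_real_def by linarith
    finally have "mean_arrivals t / t < 1 / ?E + e" .
    moreover have "1 / ?E - 1 / t \<le> mean_arrivals t / t"
    proof -
      have "t / (?E * t) \<le> ?E * (1 + mean_arrivals t) / (?E * t)"
        using mean_arrivals_lower[of t] elim E by (intro divide_right_mono) auto
      thus ?thesis using elim E by (simp add: add_divide_distrib)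
    qed
    ultimately show ?case using elim unfolding dist_real_def by linarith
  qed
qed

section \<open>Transition probabilities\<close>

text \<open>The value 0 at \<open>K\<close> lets the full system share all formulas with the other
  states.\<close>

definition admit_prob :: "nat \<Rightarrow> real" where
  "admit_prob k = (if k < K then prob {\<omega> \<in> space M. p k \<le> V 1 \<omega>} else 0)"

lemma prob_V_occ:
  assumes n: "1 \<le> n"
  shows "prob {\<omega> \<in> space M. p k \<le> V n \<omega> \<and> occ n \<omega> = k \<and> arr n \<omega> \<le> t} =
    prob {\<omega> \<in> space M. p k \<le> V 1 \<omega>} * prob {\<omega> \<in> space M. occ n \<omega> = k \<and> arr n \<omega> \<le> t}"
proof -
  let ?i = "Inr (Inr n) :: nat + nat + nat"
  \<comment> \<open>What job \<open>n\<close> finds depends on earlier jobs and on A_n, so its own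
    valuation is outside this block.\<close>
  define L where "L = {1..n} <+> {1..<n} <+> {1..<n}"
  let ?M1 = "PiM {?i} (\<lambda>_. borel) :: (nat + nat + nat \<Rightarrow> real) measure"
  let ?M2 = "PiM L (\<lambda>_. borel) :: (nat + nat + nat \<Rightarrow> real) measure"
  let ?A = "\<lambda>y. arrival_time (\<lambda>i. y (Inl i)) n"
  let ?Z = "\<lambda>y. busy K p (\<lambda>i. y (Inl i)) (\<lambda>i. y (Inr (Inl i))) (\<lambda>i. y (Inr (Inr i))) n"
  have ind: "indep_var ?M1 (block {?i}) ?M2 (block L)"
    using n by (intro indep_blocks) (auto simp: L_def)
  have [measurable]: "?A \<in> borel_measurable ?M2"
    by (intro measurable_arrival_time measurable_component_singleton) (auto simp: L_def)
  have [measurable]: "?Z \<in> measurable ?M2 (count_space UNIV)"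
    by (intro measurable_busy measurable_component_singleton) (auto simp: L_def)
  have [measurable]: "(\<lambda>x. x ?i) \<in> borel_measurable ?M1"
    by (rule measurable_component_singleton[of _ _ "\<lambda>_. borel"]) simp
  let ?C = "{x \<in> space ?M1. p k \<le> x ?i}" and ?D = "{y \<in> space ?M2. ?Z y = k \<and> ?A y \<le> t}"
  have C: "?C \<in> sets ?M1" by measurable
  have D: "?D \<in> sets ?M2" by measurable
  have A: "arrival_time (\<lambda>i. block L \<omega> (Inl i)) l = arr l \<omega>" if "l \<le> n" for l \<omega>
    unfolding arrival_time_def using that by (intro sum.cong) (auto simp: L_def)
  have Z: "?Z (block L \<omega>) = occ n \<omega>" for \<omega>
  proof (rule busy_cong)
    fix m l assume "1 \<le> m" "m < l" "l \<le> n"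
    moreover from this have "block L \<omega> (Inr (Inl m)) = S m \<omega>" by (auto simp: L_def)
    ultimately show "arrival_time (\<lambda>i. block L \<omega> (Inl i)) l
        < arrival_time (\<lambda>i. block L \<omega> (Inl i)) m + block L \<omega> (Inr (Inl m)) \<longleftrightarrow>
      arr l \<omega> < arr m \<omega> + S m \<omega>"
      using A[of l \<omega>] A[of m \<omega>] by simp
  qed (auto simp: L_def)
  note rv = measurable_space[OF indep_var_rv1[OF ind]] measurable_space[OF indep_var_rv2[OF ind]]
  have C': "block {?i} \<omega> \<in> ?C \<longleftrightarrow> p k \<le> V n \<omega>" if "\<omega> \<in> space M" for \<omega>
    using rv(1)[OF that] by simp
  have D': "block L \<omega> \<in> ?D \<longleftrightarrow> occ n \<omega> = k \<and> arr n \<omega> \<le> t" if "\<omega> \<in> space M" for \<omega>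
    using rv(2)[OF that] Z[of \<omega>] A[of n \<omega>] by (simp del: restrict_apply)
  have "prob {\<omega> \<in> space M. p k \<le> V n \<omega> \<and> occ n \<omega> = k \<and> arr n \<omega> \<le> t} =
      prob ((\<lambda>\<omega>. (block {?i} \<omega>, block L \<omega>)) -` (?C \<times> ?D) \<inter> space M)"
    using C' D' by (intro arg_cong[where f=prob]) blast
  also have "\<dots> = prob (block {?i} -` ?C \<inter> space M) * prob (block L -` ?D \<inter> space M)"
    by (rule indep_varD[OF ind C D])
  also have "block {?i} -` ?C \<inter> space M = {\<omega> \<in> space M. p k \<le> V n \<omega>}"
    using C' by blast
  also have "block L -` ?D \<inter> space M = {\<omega> \<in> space M. occ n \<omega> = k \<and> arr n \<omega> \<le> t}"
    using D' by blast
  finally show ?thesis by (simp only: prob_V_eq[OF n])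
qed

lemma survival_prob_bounds:
  "0 \<le> exp (- \<mu> * U 1 \<omega>)" "exp (- \<mu> * U 1 \<omega>) \<le> 1"
  using U_ge0[of 1 \<omega>] rate_pos by auto

text \<open>The probability that, of \<open>y\<close> jobs in service, exactly \<open>j\<close> are still there at the next arrival.\<close>

definition remain_prob :: "nat \<Rightarrow> nat \<Rightarrow> real" where
  "remain_prob y j = expectation (\<lambda>\<omega>. Bernstein y j (exp (- \<mu> * U 1 \<omega>)))"

lemma remain_prob_eq: "remain_prob y j = real (y choose j) * survival y j"
  unfolding remain_prob_def survival_def Bernstein_def mult.assoc by simp

lemma integrable_Bernstein: "integrable M (\<lambda>\<omega>. Bernstein y j (exp (- \<mu> * U 1 \<omega>)))"
proof (rule integrable_const_bound[where B="real (y choose j)"])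
  have [measurable]: "U 1 \<in> borel_measurable M" by (rule measurable_U) simp
  show "(\<lambda>\<omega>. Bernstein y j (exp (- \<mu> * U 1 \<omega>))) \<in> borel_measurable M"
    unfolding Bernstein_def by measurable
  have "x ^ j * (1 - x) ^ (y - j) \<le> 1" if "0 \<le> x" "x \<le> 1" for x :: real
    using that by (intro mult_le_one power_le_one zero_le_power) auto
  hence "norm (Bernstein y j x) \<le> real (y choose j)" if "0 \<le> x" "x \<le> 1" for x
    using that Bernstein_nonneg[OF that]
    by (auto simp: Bernstein_def mult.assoc intro!: mult_left_le)
  thus "AE \<omega> in M. norm (Bernstein y j (exp (- \<mu> * U 1 \<omega>))) \<le> real (y choose j)"
    using survival_prob_bounds by auto
qed

lemma remain_prob_nonneg: "0 \<le> remain_prob y j"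
  unfolding remain_prob_def using survival_prob_bounds
  by (intro Bochner_Integration.integral_nonneg Bernstein_nonneg)

text \<open>Total mass and mean of a binomial law with success probability exp(- \<mu> U_1),
  averaged over U_1. Allowing \<open>n\<close> above \<open>y\<close> lets all states be summed over
  the same range.\<close>

lemma remain_prob_sums:
  assumes "y \<le> n"
  shows "(\<Sum>j\<le>n. remain_prob y j) = 1"
    and "(\<Sum>j\<le>n. real j * remain_prob y j) = real y * laplace_stieltjes M (U 1) \<mu>"
proof -
  have split: "(\<Sum>j\<le>n. f j * Bernstein y j x) = (\<Sum>j\<le>y. f j * Bernstein y j x)" for f x
    using assms by (intro sum.mono_neutral_right) (auto simp: Bernstein_def)
  have "(\<Sum>j\<le>n. remain_prob y j) = expectation (\<lambda>\<omega>. \<Sum>j\<le>n. 1 * Bernstein y j (exp (- \<mu> * U 1 \<omega>)))"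
    unfolding remain_prob_def using integrable_Bernstein
    by (subst Bochner_Integration.integral_sum) auto
  thus "(\<Sum>j\<le>n. remain_prob y j) = 1"
    unfolding split by (simp add: prob_space)
  have "(\<Sum>j\<le>n. real j * remain_prob y j) =
      expectation (\<lambda>\<omega>. \<Sum>j\<le>n. real j * Bernstein y j (exp (- \<mu> * U 1 \<omega>)))"
    unfolding remain_prob_def using integrable_Bernstein
    by (subst Bochner_Integration.integral_sum) auto
  thus "(\<Sum>j\<le>n. real j * remain_prob y j) = real y * laplace_stieltjes M (U 1) \<mu>"
    unfolding split by (simp add: laplace_stieltjes_def)
qed

text \<open>Fewer jobs are more likely to be all gone, so \<open>K\<close> jobs give the worst case
  in the Doeblin bound.\<close>

lemma remain_prob_0_antimono:
  assumes "y \<le> n"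
  shows "remain_prob n 0 \<le> remain_prob y 0"
  unfolding remain_prob_def
proof (rule integral_mono[OF integrable_Bernstein integrable_Bernstein])
  fix \<omega>
  show "Bernstein n 0 (exp (- \<mu> * U 1 \<omega>)) \<le> Bernstein y 0 (exp (- \<mu> * U 1 \<omega>))"
    using survival_prob_bounds[of \<omega>] assms by (auto simp: Bernstein_def intro!: power_decreasing)
qed

text \<open>The integrand (1 - exp(- \<mu> U_1))^y can vanish only where U_1 = 0, and U_1 is not
  almost surely 0. This supplies the Doeblin constant.\<close>

lemma remain_prob_0_pos: "0 < remain_prob y 0"
proof -
  have "remain_prob y 0 \<noteq> 0"
  proof
    assume "remain_prob y 0 = 0"
    hence "AE \<omega> in M. Bernstein y 0 (exp (- \<mu> * U 1 \<omega>)) = 0"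
      unfolding remain_prob_def using survival_prob_bounds
      by (subst (asm) integral_nonneg_eq_0_iff_AE[OF integrable_Bernstein])
         (auto intro!: AE_I2 Bernstein_nonneg)
    hence "AE \<omega> in M. U 1 \<omega> = 0"
      using rate_pos by (elim AE_mp) (auto simp: Bernstein_def)
    thus False using prob_U_pos by simp
  qed
  thus ?thesis using remain_prob_nonneg[of y 0] by simp
qed

lemma laplace_stieltjes_bounds:
  "0 < laplace_stieltjes M (U 1) \<mu>" "laplace_stieltjes M (U 1) \<mu> < 1"
proof -
  have eq: "remain_prob 1 1 = laplace_stieltjes M (U 1) \<mu>"
    by (simp add: remain_prob_def Bernstein_def laplace_stieltjes_def)
  have "remain_prob 1 0 + remain_prob 1 1 = 1"
    using remain_prob_sums(1)[of 1 1] by (simp add: atMost_Suc)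
  thus "laplace_stieltjes M (U 1) \<mu> < 1"
    using remain_prob_0_pos[of 1] eq by simp
  have int: "integrable M (\<lambda>\<omega>. exp (- \<mu> * U 1 \<omega>))"
    using integrable_Bernstein[of 1 1] by (simp add: Bernstein_def)
  have "laplace_stieltjes M (U 1) \<mu> \<noteq> 0"
  proof
    assume "laplace_stieltjes M (U 1) \<mu> = 0"
    hence "AE \<omega> in M. exp (- \<mu> * U 1 \<omega>) = 0"
      unfolding laplace_stieltjes_def
      by (subst (asm) integral_nonneg_eq_0_iff_AE[OF int]) auto
    hence "AE \<omega> in M. False" by (elim AE_mp) auto
    thus False by (simp add: AE_False not_empty[symmetric] emeasure_space_1)
  qed
  moreover have "0 \<le> laplace_stieltjes M (U 1) \<mu>"
    using remain_prob_nonneg[of 1 1] eq by simp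
  ultimately show "0 < laplace_stieltjes M (U 1) \<mu>" by simp
qed

text \<open>Split by the set \<open>b\<close> in service and its surviving subset. All subsets of
  size \<open>j\<close> have the same probability, and their number turns \<open>survival\<close>
  into \<open>remain_prob\<close>.\<close>

lemma prob_next_occ:
  "prob {\<omega> \<in> space M. occ (Suc n) \<omega> = j \<and> arr n \<omega> \<le> t} =
    (\<Sum>b\<in>Pow {1..n}. remain_prob (card b) j * prob {\<omega> \<in> space M. present n \<omega> = b \<and> arr n \<omega> \<le> t})"
proof -
  let ?surv = "\<lambda>\<omega>. {m \<in> present n \<omega>. arr (Suc n) \<omega> < arr m \<omega> + S m \<omega>}"
  define E where "E b d = {\<omega> \<in> space M. present n \<omega> = b \<and> arr n \<omega> \<le> t \<and> ?surv \<omega> = d}" for b d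
  define I where "I b = {d. d \<subseteq> b \<and> card d = j}" for b :: "nat set"
  have fin: "finite (I b)" if "b \<in> Pow {1..n}" for b
    using that finite_subset[of b "{1..n}"] by (auto simp: I_def)
  have E_meas: "E b d \<in> events" if b: "b \<in> Pow {1..n}" and d: "d \<in> I b" for b d
  proof -
    have eq: "E b d = {\<omega> \<in> space M. (present n \<omega> = b \<and> arr n \<omega> \<le> t) \<and>
        (\<forall>m\<in>b. (arr (Suc n) \<omega> < arr m \<omega> + S m \<omega>) = (m \<in> d))}"
      using d by (auto simp: E_def I_def)
    have 1: "Measurable.pred M (\<lambda>\<omega>. present n \<omega> = b \<and> arr n \<omega> \<le> t)"
      using measurable_present measurable_arr by measurable
    have 2: "Measurable.pred M (\<lambda>\<omega>. (arr (Suc n) \<omega> < arr m \<omega> + S m \<omega>) = (m \<in> d))" if "m \<in> b" for m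
    proof -
      have [measurable]: "S m \<in> borel_measurable M" using that b by (intro measurable_S) auto
      note [measurable] = measurable_arr[of m] measurable_arr[of "Suc n"]
      show ?thesis by measurable
    qed
    have "finite b" using b finite_subset[of b "{1..n}"] by auto
    from pred_intros_logic(3)[OF 1 pred_intros_finite(3)[OF this 2]]
    show ?thesis unfolding eq by (simp add: pred_def)
  qed
  have occ: "occ (Suc n) \<omega> = card (?surv \<omega>)" for \<omega>
    by (rule busy_Suc_eq_card) (rule U_ge0)
  have sub: "present n \<omega> \<in> Pow {1..n}" for \<omega> by (auto simp: in_service_def)
  have "{\<omega> \<in> space M. occ (Suc n) \<omega> = j \<and> arr n \<omega> \<le> t} = (\<Union>(b, d)\<in>Sigma (Pow {1..n}) I. E b d)"
    using sub by (auto simp: E_def I_def occ)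
  also have "prob \<dots> = (\<Sum>(b, d)\<in>Sigma (Pow {1..n}) I. prob (E b d))"
    using fin E_meas unfolding split_def
    by (intro finite_measure_finite_Union) (auto simp: disjoint_family_on_def E_def)
  also have "\<dots> = (\<Sum>b\<in>Pow {1..n}. \<Sum>d\<in>I b. prob (E b d))"
    using fin by (subst sum.Sigma) auto
  also have "\<dots> = (\<Sum>b\<in>Pow {1..n}. remain_prob (card b) j *
      prob {\<omega> \<in> space M. present n \<omega> = b \<and> arr n \<omega> \<le> t})"
  proof (rule sum.cong)
    fix b assume b: "b \<in> Pow {1..n}"
    have "prob (E b d) = survival (card b) j * prob {\<omega> \<in> space M. present n \<omega> = b \<and> arr n \<omega> \<le> t}"
      if "d \<in> I b" for d
      unfolding E_def using prob_present_survivors[of b n d t] b that by (auto simp: I_def)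
    hence "(\<Sum>d\<in>I b. prob (E b d)) = real (card (I b)) * (survival (card b) j *
        prob {\<omega> \<in> space M. present n \<omega> = b \<and> arr n \<omega> \<le> t})"
      by simp
    also have "card (I b) = card b choose j"
      unfolding I_def using b finite_subset[of b "{1..n}"] by (intro n_subsets) auto
    finally show "(\<Sum>d\<in>I b. prob (E b d)) = remain_prob (card b) j *
        prob {\<omega> \<in> space M. present n \<omega> = b \<and> arr n \<omega> \<le> t}"
      by (simp add: remain_prob_eq)
  qed simp
  finally show ?thesis .
qed

text \<open>The kernel of the chain of occupancies seen by successive arrivals: the admission
  decision, then thinning over one interarrival time.\<close>

definition trans_prob :: "nat \<Rightarrow> nat \<Rightarrow> real" where
  "trans_prob i j = admit_prob i * remain_prob (Suc i) j + (1 - admit_prob i) * remain_prob i j"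

text \<open>The horizon is A_n <= t on both sides, not A_{n+1} <= t: the latter would bias the
  interarrival time over which the jobs are thinned.\<close>

lemma prob_occ_step:
  assumes n: "1 \<le> n"
  shows "prob {\<omega> \<in> space M. occ (Suc n) \<omega> = j \<and> arr n \<omega> \<le> t} =
    (\<Sum>i\<le>K. prob {\<omega> \<in> space M. occ n \<omega> = i \<and> arr n \<omega> \<le> t} * trans_prob i j)"
proof -
  note [measurable] = measurable_arr measurable_occ measurable_V[OF n] measurable_S[OF n]
  let ?G = "\<lambda>y. remain_prob y j"
  let ?a = "\<lambda>i \<omega>. of_bool (occ n \<omega> = i \<and> arr n \<omega> \<le> t) :: real"
  \<comment> \<open>\<open>?c i\<close> marks an admission in state \<open>i\<close>, where
    \<open>i + 1\<close> jobs are then in service; \<open>?a i - ?c i\<close> marks a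
    rejection.\<close>
  let ?c = "\<lambda>i \<omega>. of_bool (i < K \<and> p i \<le> V n \<omega> \<and> occ n \<omega> = i \<and> arr n \<omega> \<le> t) :: real"
  have a_pred: "Measurable.pred M (\<lambda>\<omega>. occ n \<omega> = i \<and> arr n \<omega> \<le> t)" for i by measurable
  have c_pred: "Measurable.pred M (\<lambda>\<omega>. i < K \<and> p i \<le> V n \<omega> \<and> occ n \<omega> = i \<and> arr n \<omega> \<le> t)" for i
    by measurable
  have b_pred: "Measurable.pred M (\<lambda>\<omega>. present n \<omega> = b \<and> arr n \<omega> \<le> t)" for b
    using measurable_present by measurable
  have Ea: "expectation (?a i) = prob {\<omega> \<in> space M. occ n \<omega> = i \<and> arr n \<omega> \<le> t}" for i
    by (rule prob_eq_expectation[OF a_pred, symmetric])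
  have Ec: "expectation (?c i) = admit_prob i * expectation (?a i)" for i
    unfolding prob_eq_expectation[OF c_pred, symmetric] Ea
    using prob_V_occ[OF n, of i t] by (cases "i < K") (simp_all add: admit_prob_def)
  have S_pos: "AE \<omega> in M. 0 < S n \<omega>"
    using prob_S_gt[OF n, of 0] prob_Collect_eq_1[of "\<lambda>\<omega>. 0 < S n \<omega>"] by simp
  have sub: "present n \<omega> \<in> Pow {1..n}" for \<omega> by (auto simp: in_service_def)
  have "prob {\<omega> \<in> space M. occ (Suc n) \<omega> = j \<and> arr n \<omega> \<le> t} =
      expectation (\<lambda>\<omega>. \<Sum>b\<in>Pow {1..n}. ?G (card b) * of_bool (present n \<omega> = b \<and> arr n \<omega> \<le> t))"
    unfolding prob_next_occ prob_eq_expectation[OF b_pred]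
    using integrable_of_bool[OF b_pred] by (subst Bochner_Integration.integral_sum) auto
  also have "\<dots> = expectation (\<lambda>\<omega>. \<Sum>i\<le>K. ?G (Suc i) * ?c i \<omega> + ?G i * (?a i \<omega> - ?c i \<omega>))"
  proof (rule integral_cong_AE)
    show "AE \<omega> in M. (\<Sum>b\<in>Pow {1..n}. ?G (card b) * of_bool (present n \<omega> = b \<and> arr n \<omega> \<le> t)) =
        (\<Sum>i\<le>K. ?G (Suc i) * ?c i \<omega> + ?G i * (?a i \<omega> - ?c i \<omega>))"
      using S_pos
    proof eventually_elim
      case (elim \<omega>)
      have "(\<Sum>b\<in>Pow {1..n}. ?G (card b) * of_bool (present n \<omega> = b \<and> arr n \<omega> \<le> t)) =
          (\<Sum>b\<in>Pow {1..n}. if b = present n \<omega> then ?G (card b) * of_bool (arr n \<omega> \<le> t) else 0)"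
        by (intro sum.cong) auto
      also have "\<dots> = ?G (card (present n \<omega>)) * of_bool (arr n \<omega> \<le> t)"
        using sub by (subst sum.delta) auto
      also have "card (present n \<omega>) = occ n \<omega> + of_bool (adm n \<omega>)"
        by (rule card_in_service[OF n]) (rule elim)
      also have "?G (occ n \<omega> + of_bool (adm n \<omega>)) * of_bool (arr n \<omega> \<le> t) =
          (\<Sum>i\<le>K. if i = occ n \<omega> then ?G (i + of_bool (i < K \<and> p i \<le> V n \<omega>)) * of_bool (arr n \<omega> \<le> t) else 0)"
        using busy_le[of "\<lambda>i. U i \<omega>" K p] U_ge0 by (subst sum.delta) (auto simp: admitted_def)
      also have "\<dots> = (\<Sum>i\<le>K. ?G (Suc i) * ?c i \<omega> + ?G i * (?a i \<omega> - ?c i \<omega>))"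
        by (intro sum.cong) auto
      finally show ?case .
    qed
    show "(\<lambda>\<omega>. \<Sum>b\<in>Pow {1..n}. ?G (card b) * of_bool (present n \<omega> = b \<and> arr n \<omega> \<le> t)) \<in> borel_measurable M"
      using borel_measurable_integrable[OF integrable_of_bool[OF b_pred]]
      by (intro borel_measurable_sum borel_measurable_times) auto
    show "(\<lambda>\<omega>. \<Sum>i\<le>K. ?G (Suc i) * ?c i \<omega> + ?G i * (?a i \<omega> - ?c i \<omega>)) \<in> borel_measurable M"
      using borel_measurable_integrable[OF integrable_of_bool[OF a_pred]]
        borel_measurable_integrable[OF integrable_of_bool[OF c_pred]]
      by (intro borel_measurable_sum borel_measurable_add borel_measurable_times borel_measurable_diff) auto
  qed
  also have "\<dots> = (\<Sum>i\<le>K. ?G (Suc i) * expectation (?c i) + ?G i * (expectation (?a i) - expectation (?c i)))"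
    using integrable_of_bool[OF a_pred] integrable_of_bool[OF c_pred]
    by (subst Bochner_Integration.integral_sum) auto
  also have "\<dots> = (\<Sum>i\<le>K. prob {\<omega> \<in> space M. occ n \<omega> = i \<and> arr n \<omega> \<le> t} * trans_prob i j)"
    unfolding Ec Ea trans_prob_def by (intro sum.cong) (auto simp: algebra_simps)
  finally show ?thesis .
qed

section \<open>Mean numbers of visits and the revenue\<close>

text \<open>This is h_k(t); \<open>Suc n\<close> appears because jobs are numbered from 1.\<close>

definition mean_visits :: "nat \<Rightarrow> real \<Rightarrow> real" where
  "mean_visits k t = (\<Sum>n. prob {\<omega> \<in> space M. occ (Suc n) \<omega> = k \<and> arr (Suc n) \<omega> \<le> t})"

lemma prob_conj_arr_le:
  "prob {\<omega> \<in> space M. Q \<omega> \<and> arr n \<omega> \<le> t} \<le> prob {\<omega> \<in> space M. arr n \<omega> \<le> t}"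
  using measurable_arr[of n] by (intro finite_measure_mono) auto

lemma summable_prob_conj_arr:
  assumes t: "0 \<le> t"
  shows "summable (\<lambda>n. prob {\<omega> \<in> space M. Q n \<omega> \<and> arr (Suc n) \<omega> \<le> t})"
  by (rule summable_comparison_test'[OF summable_ignore_initial_segment[OF summable_prob_arr[OF t], of 1]])
     (use prob_conj_arr_le in auto)

lemma mean_visits_nonneg: "0 \<le> t \<Longrightarrow> 0 \<le> mean_visits k t"
  unfolding mean_visits_def
  by (intro suminf_nonneg summable_prob_conj_arr[of t "\<lambda>n \<omega>. occ (Suc n) \<omega> = k"]) auto

lemma occ_le: "occ n \<omega> \<le> K"
  by (rule busy_le) (rule U_ge0)

lemma sum_mean_visits:
  assumes t: "0 \<le> t"
  shows "(\<Sum>k\<le>K. mean_visits k t) = mean_arrivals t"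
proof -
  have "(\<Sum>k\<le>K. mean_visits k t) =
      (\<Sum>n. \<Sum>k\<le>K. prob {\<omega> \<in> space M. occ (Suc n) \<omega> = k \<and> arr (Suc n) \<omega> \<le> t})"
    unfolding mean_visits_def
    using summable_prob_conj_arr[OF t, of "\<lambda>n \<omega>. occ (Suc n) \<omega> = k" for k]
    by (subst suminf_sum) auto
  also have "\<dots> = mean_arrivals t"
    unfolding mean_arrivals_def
  proof (intro arg_cong[where f=suminf] ext)
    fix n
    note [measurable] = measurable_arr measurable_occ
    have "{\<omega> \<in> space M. arr (Suc n) \<omega> \<le> t} =
        (\<Union>k\<in>{..K}. {\<omega> \<in> space M. occ (Suc n) \<omega> = k \<and> arr (Suc n) \<omega> \<le> t})"
      using occ_le by auto
    also have "prob \<dots> = (\<Sum>k\<le>K. prob {\<omega> \<in> space M. occ (Suc n) \<omega> = k \<and> arr (Suc n) \<omega> \<le> t})"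
      by (intro finite_measure_finite_Union) (auto simp: disjoint_family_on_def)
    finally show "(\<Sum>k\<le>K. prob {\<omega> \<in> space M. occ (Suc n) \<omega> = k \<and> arr (Suc n) \<omega> \<le> t}) =
        prob {\<omega> \<in> space M. arr (Suc n) \<omega> \<le> t}" by simp
  qed
  finally show ?thesis .
qed

text \<open>
  The stationarity equations hold up to a bounded error because replacing \<open>A\<^sub>n \<le> t\<close> by
  \<open>A\<^bsub>n+1\<^esub> \<le> t\<close> affects only one arrival per path.
\<close>

lemma mean_visits_almost_stationary:
  assumes t: "0 \<le> t"
  shows mean_visits_le: "1 \<le> j \<Longrightarrow> mean_visits j t \<le> (\<Sum>i\<le>K. mean_visits i t * trans_prob i j)"
    and mean_visits_step: "\<bar>mean_visits j t - (\<Sum>i\<le>K. mean_visits i t * trans_prob i j)\<bar> \<le> 1"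
proof -
  note [measurable] = measurable_arr measurable_occ
  \<comment> \<open>\<open>b n\<close> and \<open>a (Suc n)\<close> concern the state found by the
    same job, with the clock read one arrival earlier in \<open>b n\<close>;
    \<open>r n - r (Suc n)\<close> is the probability that t separates the two readings.\<close>
  define a where "a n = prob {\<omega> \<in> space M. occ (Suc n) \<omega> = j \<and> arr (Suc n) \<omega> \<le> t}" for n
  define b where "b n = prob {\<omega> \<in> space M. occ (Suc (Suc n)) \<omega> = j \<and> arr (Suc n) \<omega> \<le> t}" for n
  define r where "r n = prob {\<omega> \<in> space M. arr (Suc n) \<omega> \<le> t}" for n
  have sum_a: "summable a" unfolding a_def by (rule summable_prob_conj_arr[OF t])
  have sum_b: "summable b" unfolding b_def by (rule summable_prob_conj_arr[OF t])
  have "r \<longlonglongrightarrow> 0"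
    unfolding r_def using summable_LIMSEQ_zero[OF summable_prob_arr[OF t]] by (rule LIMSEQ_Suc)
  hence r: "(\<lambda>n. r n - r (Suc n)) sums (r 0)"
    using telescope_sums'[of r 0] by simp
  have le1: "a (Suc n) \<le> b n" for n
    unfolding a_def b_def
  proof (intro finite_measure_mono)
    show "{\<omega> \<in> space M. occ (Suc (Suc n)) \<omega> = j \<and> arr (Suc (Suc n)) \<omega> \<le> t} \<subseteq>
        {\<omega> \<in> space M. occ (Suc (Suc n)) \<omega> = j \<and> arr (Suc n) \<omega> \<le> t}"
      using arr_mono[of "Suc n" "Suc (Suc n)"] by (auto intro: order_trans)
  qed measurable
  have le2: "b n - a (Suc n) \<le> r n - r (Suc n)" for n
  proof -
    have sub: "{\<omega> \<in> space M. arr (Suc (Suc n)) \<omega> \<le> t} \<subseteq> {\<omega> \<in> space M. arr (Suc n) \<omega> \<le> t}"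
      using arr_mono[of "Suc n" "Suc (Suc n)"] by (auto intro: order_trans)
    have "b n \<le> prob ({\<omega> \<in> space M. occ (Suc (Suc n)) \<omega> = j \<and> arr (Suc (Suc n)) \<omega> \<le> t} \<union>
        ({\<omega> \<in> space M. arr (Suc n) \<omega> \<le> t} - {\<omega> \<in> space M. arr (Suc (Suc n)) \<omega> \<le> t}))"
      unfolding b_def by (intro finite_measure_mono) auto
    also have "\<dots> \<le> a (Suc n) + prob ({\<omega> \<in> space M. arr (Suc n) \<omega> \<le> t} - {\<omega> \<in> space M. arr (Suc (Suc n)) \<omega> \<le> t})"
      unfolding a_def by (intro measure_Un_le) auto
    also have "prob ({\<omega> \<in> space M. arr (Suc n) \<omega> \<le> t} - {\<omega> \<in> space M. arr (Suc (Suc n)) \<omega> \<le> t}) = r n - r (Suc n)"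
      unfolding r_def using sub by (intro finite_measure_Diff) auto
    finally show ?thesis by simp
  qed
  have sum_aS: "summable (\<lambda>n. a (Suc n))" using sum_a by (simp add: summable_Suc_iff)
  have diff: "suminf b - (\<Sum>n. a (Suc n)) = (\<Sum>n. b n - a (Suc n))"
    by (rule suminf_diff[OF sum_b sum_aS])
  have "0 \<le> (\<Sum>n. b n - a (Suc n))"
    using le1 by (intro suminf_nonneg summable_diff sum_b sum_aS) auto
  moreover have "(\<Sum>n. b n - a (Suc n)) \<le> (\<Sum>n. r n - r (Suc n))"
    by (intro suminf_le le2 summable_diff[OF sum_b sum_aS] sums_summable[OF r])
  moreover have "(\<Sum>n. r n - r (Suc n)) \<le> 1"
    unfolding sums_unique[OF r, symmetric] by (simp add: r_def)
  moreover have "mean_visits j t = a 0 + (\<Sum>n. a (Suc n))"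
    unfolding mean_visits_def a_def[symmetric] using suminf_split_head[OF sum_a] by simp
  moreover have "(\<Sum>i\<le>K. mean_visits i t * trans_prob i j) = suminf b"
  proof -
    have "(\<Sum>i\<le>K. mean_visits i t * trans_prob i j) =
        (\<Sum>n. \<Sum>i\<le>K. prob {\<omega> \<in> space M. occ (Suc n) \<omega> = i \<and> arr (Suc n) \<omega> \<le> t} * trans_prob i j)"
      unfolding mean_visits_def
      using summable_prob_conj_arr[OF t, of "\<lambda>n \<omega>. occ (Suc n) \<omega> = i" for i]
      by (subst suminf_sum) (auto simp: suminf_mult2 intro!: summable_mult2)
    also have "\<dots> = suminf b"
      unfolding b_def by (subst prob_occ_step) simp_all
    finally show ?thesis .
  qed
  moreover have "0 \<le> a 0" "a 0 \<le> 1" by (simp_all add: a_def)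
  \<comment> \<open>The first job finds an empty system. So for j >= 1 the inequality has no error
    term, which is what makes the final comparison valid at each finite t.\<close>
  moreover have "a 0 = 0" if "1 \<le> j"
    unfolding a_def using that by (simp add: busy_eq_card_admitted)
  ultimately show "1 \<le> j \<Longrightarrow> mean_visits j t \<le> (\<Sum>i\<le>K. mean_visits i t * trans_prob i j)"
    "\<bar>mean_visits j t - (\<Sum>i\<le>K. mean_visits i t * trans_prob i j)\<bar> \<le> 1"
    using diff by linarith+
qed

lemma admit_prob_bounds: "0 \<le> admit_prob k" "admit_prob k \<le> 1"
  by (auto simp: admit_prob_def)

lemma trans_prob_nonneg: "0 \<le> trans_prob i j"
  unfolding trans_prob_def using admit_prob_bounds remain_prob_nonneg by simp

text \<open>On average \<open>i + admit_prob i\<close> jobs are in service after the decision, and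
  each stays with probability \<phi>(\<mu>). For \<open>i = K\<close> the row \<open>Suc K\<close>,
  which would leave the range, has weight \<open>admit_prob K = 0\<close>.\<close>

lemma trans_prob_sums:
  assumes i: "i \<le> K"
  shows "(\<Sum>j\<le>K. trans_prob i j) = 1"
    and "(\<Sum>j\<le>K. real j * trans_prob i j) = (real i + admit_prob i) * laplace_stieltjes M (U 1) \<mu>"
proof -
  show "(\<Sum>j\<le>K. trans_prob i j) = 1"
    using i remain_prob_sums(1)[of i K] remain_prob_sums(1)[of "Suc i" K]
    unfolding trans_prob_def sum.distrib sum_distrib_left[symmetric]
    by (cases "i = K") (auto simp: admit_prob_def)
  have "(\<Sum>j\<le>K. real j * trans_prob i j) = admit_prob i * (\<Sum>j\<le>K. real j * remain_prob (Suc i) j) +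
      (1 - admit_prob i) * (\<Sum>j\<le>K. real j * remain_prob i j)"
    unfolding trans_prob_def sum_distrib_left sum.distrib[symmetric]
    by (intro sum.cong) (auto simp: algebra_simps)
  thus "(\<Sum>j\<le>K. real j * trans_prob i j) = (real i + admit_prob i) * laplace_stieltjes M (U 1) \<mu>"
    using i remain_prob_sums(2)[of i K] remain_prob_sums(2)[of "Suc i" K]
    by (cases "i = K") (auto simp: admit_prob_def algebra_simps)
qed

text \<open>The Doeblin minorization: after any decision at most \<open>K\<close> jobs are in
  service.\<close>

lemma trans_prob_0_ge:
  assumes i: "i \<le> K"
  shows "remain_prob K 0 \<le> trans_prob i 0"
proof (cases "i = K")
  case True
  thus ?thesis by (simp add: trans_prob_def admit_prob_def)
next
  case False
  have "remain_prob K 0 = admit_prob i * remain_prob K 0 + (1 - admit_prob i) * remain_prob K 0"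
    by (simp add: algebra_simps)
  also have "\<dots> \<le> trans_prob i 0"
    unfolding trans_prob_def using admit_prob_bounds False i
    by (intro add_mono mult_left_mono remain_prob_0_antimono) auto
  finally show ?thesis .
qed

lemma mean_visits_tendsto:
  assumes "k \<le> K"
  shows "\<exists>L. ((\<lambda>t. mean_visits k t / t) \<longlongrightarrow> L) at_top"
proof (rule tendsto_if_almost_stationary[OF trans_prob_nonneg trans_prob_sums(1) remain_prob_0_pos
      trans_prob_0_ge mean_visits_step _ assms])
  have "eventually (\<lambda>t. mean_arrivals t / t = (\<Sum>j\<le>K. mean_visits j t) / t) at_top"
    using eventually_ge_at_top[of 0] by eventually_elim (simp add: sum_mean_visits)
  thus "((\<lambda>t. (\<Sum>j\<le>K. mean_visits j t) / t) \<longlongrightarrow> 1 / expectation (U 1)) at_top"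
    by (rule Lim_transform_eventually[OF mean_arrivals_tendsto, rotated])
qed

text \<open>
  Balance of the mean number of busy servers: between two arrivals each busy server is freed with
  probability \<open>1 - \<phi>(\<mu>)\<close>, and these departures must be compensated by admissions.
\<close>

lemma mean_visits_full_le:
  assumes t: "0 \<le> t"
  shows "(1 - laplace_stieltjes M (U 1) \<mu>) * (real K * mean_visits K t) \<le>
    laplace_stieltjes M (U 1) \<mu> * (\<Sum>k<K. mean_visits k t)"
proof -
  let ?\<phi> = "laplace_stieltjes M (U 1) \<mu>"
  define z where "z = (\<Sum>j\<le>K. real j * mean_visits j t)"
  have "z \<le> (\<Sum>j\<le>K. real j * (\<Sum>i\<le>K. mean_visits i t * trans_prob i j))"
    unfolding z_def
  proof (rule sum_mono)
    fix j
    show "real j * mean_visits j t \<le> real j * (\<Sum>i\<le>K. mean_visits i t * trans_prob i j)"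
      using mean_visits_le[OF t, of j] by (cases "j = 0") auto
  qed
  also have "\<dots> = (\<Sum>i\<le>K. mean_visits i t * (\<Sum>j\<le>K. real j * trans_prob i j))"
    unfolding sum_distrib_left by (subst sum.swap) (simp add: mult_ac)
  also have "\<dots> = (\<Sum>i\<le>K. mean_visits i t * ((real i + admit_prob i) * ?\<phi>))"
    by (simp add: trans_prob_sums(2))
  also have "\<dots> = ?\<phi> * (z + (\<Sum>i\<le>K. admit_prob i * mean_visits i t))"
    unfolding z_def sum.distrib[symmetric] sum_distrib_left by (simp add: algebra_simps)
  also have "(\<Sum>i\<le>K. admit_prob i * mean_visits i t) = (\<Sum>i<K. admit_prob i * mean_visits i t)"
    by (simp add: lessThan_Suc_atMost[symmetric] admit_prob_def)
  finally have "(1 - ?\<phi>) * z \<le> ?\<phi> * (\<Sum>i<K. admit_prob i * mean_visits i t)"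
    by (simp add: algebra_simps)
  also have "\<dots> \<le> ?\<phi> * (\<Sum>k<K. mean_visits k t)"
    using laplace_stieltjes_bounds admit_prob_bounds mean_visits_nonneg[OF t]
    by (intro mult_left_mono sum_mono mult_left_le_one_le) auto
  finally have "(1 - ?\<phi>) * z \<le> ?\<phi> * (\<Sum>k<K. mean_visits k t)" .
  \<comment> \<open>Of the mean number of busy servers only the full state is kept; this is the
    origin of the factor \<open>K\<close> in the bound.\<close>
  moreover have "real K * mean_visits K t \<le> z"
    unfolding z_def using mean_visits_nonneg[OF t]
    by (intro member_le_sum[of K _ "\<lambda>j. real j * mean_visits j t"]) auto
  ultimately show ?thesis
    using laplace_stieltjes_bounds by (meson diff_ge_0_iff_ge less_imp_le mult_left_mono order_trans)
qed

end

section \<open>Expected revenue and existence of the revenue rate\<close>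

context pricing_system
begin

text \<open>Proved for interarrival times that are nonnegative only almost surely, because the
  reduction to \<open>max 0 (U n)\<close> compares the revenues of both systems.\<close>

lemma measurable_cumulative_revenue:
  "(\<lambda>\<omega>. cumulative_revenue K p (\<lambda>n. U n \<omega>) (\<lambda>n. S n \<omega>) (\<lambda>n. V n \<omega>) t) \<in> borel_measurable M"
  unfolding cumulative_revenue_def
proof (rule measurable_compose_countable)
  have A: "(\<lambda>\<omega>. arrival_time (\<lambda>i. U i \<omega>) n) \<in> borel_measurable M" for n
    by (intro measurable_arrival_time measurable_U)
  show "(\<lambda>\<omega>. num_arrivals (\<lambda>n. U n \<omega>) t) \<in> measurable M (count_space UNIV)"
    unfolding num_arrivals_def
  proof (rule measurable_card)
    fix n
    note [measurable] = A[of n]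
    show "{\<omega> \<in> space M. n \<in> {n. 1 \<le> n \<and> arrival_time (\<lambda>n. U n \<omega>) n \<le> t}} \<in> events"
      by measurable
  qed
  fix N :: nat
  show "(\<lambda>\<omega>. \<Sum>n=1..N. \<Sum>k<K. p k * of_bool (p k \<le> V n \<omega>) *
      of_bool (busy K p (\<lambda>n. U n \<omega>) (\<lambda>n. S n \<omega>) (\<lambda>n. V n \<omega>) n = k)) \<in> borel_measurable M"
  proof (intro borel_measurable_sum)
    fix n k assume "n \<in> {1..N}"
    hence [measurable]: "V n \<in> borel_measurable M" by (intro measurable_V) auto
    have [measurable]: "(\<lambda>\<omega>. busy K p (\<lambda>n. U n \<omega>) (\<lambda>n. S n \<omega>) (\<lambda>n. V n \<omega>) n) \<in> measurable M (count_space UNIV)"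
      by (intro measurable_busy measurable_U measurable_S measurable_V) auto
    show "(\<lambda>\<omega>. p k * of_bool (p k \<le> V n \<omega>) *
      of_bool (busy K p (\<lambda>n. U n \<omega>) (\<lambda>n. S n \<omega>) (\<lambda>n. V n \<omega>) n = k)) \<in> borel_measurable M"
      by measurable
  qed
qed

end

context nonneg_pricing_system
begin

abbreviation revenue :: "real \<Rightarrow> 'a \<Rightarrow> real" where
  "revenue t \<omega> \<equiv> cumulative_revenue K p (\<lambda>n. U n \<omega>) (\<lambda>n. S n \<omega>) (\<lambda>n. V n \<omega>) t"

text \<open>The random sum is rewritten as a series over all jobs whose terms vanish after t;
  summability of P(A_n <= t) permits the exchange of series and expectation.\<close>

lemma expectation_revenue:
  assumes t: "0 \<le> t"
  shows "expectation (revenue t) = (\<Sum>k<K. p k * admit_prob k * mean_visits k t)"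
proof -
  note [measurable] = measurable_arr measurable_occ
  define e where "e k n \<omega> = (of_bool (p k \<le> V (Suc n) \<omega> \<and> occ (Suc n) \<omega> = k \<and> arr (Suc n) \<omega> \<le> t) :: real)" for k n \<omega>
  define f where "f n \<omega> = (\<Sum>k<K. p k * e k n \<omega>)" for n \<omega>
  have e_pred: "Measurable.pred M (\<lambda>\<omega>. p k \<le> V (Suc n) \<omega> \<and> occ (Suc n) \<omega> = k \<and> arr (Suc n) \<omega> \<le> t)" for k n
  proof -
    have [measurable]: "V (Suc n) \<in> borel_measurable M" by (rule measurable_V) simp
    show ?thesis by measurable
  qed
  have int_e: "integrable M (e k n)" for k n
    unfolding e_def by (rule integrable_of_bool[OF e_pred])
  have Ee: "expectation (e k n) = admit_prob k * prob {\<omega> \<in> space M. occ (Suc n) \<omega> = k \<and> arr (Suc n) \<omega> \<le> t}"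
    if "k < K" for k n
    unfolding e_def prob_eq_expectation[OF e_pred, symmetric]
    using prob_V_occ[of "Suc n" k t] that by (simp add: admit_prob_def)
  have int_f: "integrable M (f n)" for n
    unfolding f_def using int_e by auto
  \<comment> \<open>\<open>num_arrivals\<close> counts correctly only if finitely many jobs arrive
    by t, which Borel-Cantelli gives almost surely.\<close>
  have AE_fin: "AE \<omega> in M. finite {n. arr (Suc n) \<omega> \<le> t}"
  proof -
    have "AE \<omega> in M. eventually (\<lambda>n. \<omega> \<in> space M - {\<omega> \<in> space M. arr n \<omega> \<le> t}) sequentially"
      using summable_prob_arr[OF t] by (intro borel_cantelli_AE1) (auto simp: emeasure_eq_measure)
    thus ?thesis
    proof eventually_elim
      case (elim \<omega>)
      then obtain N where N: "\<And>n. N \<le> n \<Longrightarrow> \<omega> \<in> space M - {\<omega> \<in> space M. arr n \<omega> \<le> t}"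
        by (auto simp: eventually_sequentially)
      have "n < N" if "arr (Suc n) \<omega> \<le> t" for n
        using N[of "Suc n"] that by (force simp: not_le[symmetric])
      hence "{n. arr (Suc n) \<omega> \<le> t} \<subseteq> {..<N}" by auto
      thus ?case using finite_subset by blast
    qed
  qed
  have revenue_eq: "revenue t \<omega> = (\<Sum>n. f n \<omega>)" "summable (\<lambda>n. norm (f n \<omega>))"
    if fin: "finite {n. arr (Suc n) \<omega> \<le> t}" for \<omega>
  proof -
    have f0: "f n \<omega> = 0" if "\<not> arr (Suc n) \<omega> \<le> t" for n
      using that by (simp add: f_def e_def)
    have "revenue t \<omega> = (\<Sum>n\<in>Suc ` {n. arr (Suc n) \<omega> \<le> t}.
        \<Sum>k<K. p k * of_bool (p k \<le> V n \<omega>) * of_bool (occ n \<omega> = k))"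
      unfolding cumulative_revenue_def
      by (subst image_Suc_arrivals[OF U_ge0 fin]) simp_all
    also have "\<dots> = (\<Sum>n\<in>{n. arr (Suc n) \<omega> \<le> t}. f n \<omega>)"
      by (subst sum.reindex) (auto simp: f_def e_def intro!: sum.cong)
    also have "\<dots> = (\<Sum>n. f n \<omega>)"
      using f0 by (intro suminf_finite[OF fin, symmetric]) blast
    finally show "revenue t \<omega> = (\<Sum>n. f n \<omega>)" .
    show "summable (\<lambda>n. norm (f n \<omega>))"
      using f0 by (intro summable_finite[OF fin]) auto
  qed
  have sum_norm: "summable (\<lambda>n. expectation (\<lambda>\<omega>. norm (f n \<omega>)))"
  proof (rule summable_comparison_test')
    show "summable (\<lambda>n. (\<Sum>k<K. \<bar>p k\<bar>) * prob {\<omega> \<in> space M. arr (Suc n) \<omega> \<le> t})"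
      using summable_ignore_initial_segment[OF summable_prob_arr[OF t], of 1]
      by (intro summable_mult) simp
    fix n
    have pr: "Measurable.pred M (\<lambda>\<omega>. arr (Suc n) \<omega> \<le> t)" by measurable
    have "expectation (\<lambda>\<omega>. norm (f n \<omega>)) \<le>
        expectation (\<lambda>\<omega>. (\<Sum>k<K. \<bar>p k\<bar>) * of_bool (arr (Suc n) \<omega> \<le> t))"
    proof (rule integral_mono)
      show "integrable M (\<lambda>\<omega>. norm (f n \<omega>))" using int_f by (rule integrable_norm)
      show "integrable M (\<lambda>\<omega>. (\<Sum>k<K. \<bar>p k\<bar>) * of_bool (arr (Suc n) \<omega> \<le> t))"
        by (intro integrable_mult_right integrable_of_bool[OF pr])
      fix \<omega>
      have "norm (f n \<omega>) \<le> (\<Sum>k<K. \<bar>p k * e k n \<omega>\<bar>)"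
        unfolding f_def by (simp add: sum_abs)
      also have "\<dots> \<le> (\<Sum>k<K. \<bar>p k\<bar> * of_bool (arr (Suc n) \<omega> \<le> t))"
        by (intro sum_mono) (auto simp: e_def)
      finally show "norm (f n \<omega>) \<le> (\<Sum>k<K. \<bar>p k\<bar>) * of_bool (arr (Suc n) \<omega> \<le> t)"
        by (simp add: sum_distrib_right)
    qed
    thus "norm (expectation (\<lambda>\<omega>. norm (f n \<omega>))) \<le>
        (\<Sum>k<K. \<bar>p k\<bar>) * prob {\<omega> \<in> space M. arr (Suc n) \<omega> \<le> t}"
      by (simp add: prob_eq_expectation[OF pr])
  qed
  have AE_sum: "AE \<omega> in M. summable (\<lambda>n. norm (f n \<omega>))"
    using AE_fin by eventually_elim (rule revenue_eq(2))
  have "expectation (revenue t) = expectation (\<lambda>\<omega>. \<Sum>n. f n \<omega>)"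
    using AE_fin
    by (intro integral_cong_AE measurable_cumulative_revenue borel_measurable_suminf
        borel_measurable_integrable[OF int_f]) (auto simp: revenue_eq(1))
  also have "\<dots> = (\<Sum>n. expectation (f n))"
    by (rule integral_suminf[OF int_f AE_sum sum_norm])
  also have "\<dots> = (\<Sum>n. \<Sum>k<K. p k * admit_prob k *
      prob {\<omega> \<in> space M. occ (Suc n) \<omega> = k \<and> arr (Suc n) \<omega> \<le> t})"
    unfolding f_def using int_e
    by (subst Bochner_Integration.integral_sum) (auto simp: Ee mult.assoc)
  also have "\<dots> = (\<Sum>k<K. p k * admit_prob k * mean_visits k t)"
    unfolding mean_visits_def
    using summable_prob_conj_arr[OF t, of "\<lambda>n \<omega>. occ (Suc n) \<omega> = k" for k]
    by (subst suminf_sum) (auto simp: suminf_mult intro!: summable_mult)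
  finally show ?thesis .
qed

text \<open>Shows that the \<open>Lim\<close> in \<open>revenue_rate\<close> is an actual limit, so
  that inequalities at each t pass to the rates.\<close>

lemma revenue_rate_tendsto:
  "((\<lambda>t. expectation (revenue t) / t) \<longlongrightarrow> revenue_rate M U S V K p) at_top"
proof -
  have "\<exists>L. \<forall>k\<le>K. ((\<lambda>t. mean_visits k t / t) \<longlongrightarrow> L k) at_top"
    using mean_visits_tendsto by metis
  then obtain L where L: "\<And>k. k \<le> K \<Longrightarrow> ((\<lambda>t. mean_visits k t / t) \<longlongrightarrow> L k) at_top"
    by blast
  have "((\<lambda>t. \<Sum>k<K. p k * admit_prob k * (mean_visits k t / t)) \<longlongrightarrow>
      (\<Sum>k<K. p k * admit_prob k * L k)) at_top"
    by (intro tendsto_sum tendsto_mult tendsto_const L) auto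
  moreover have "eventually (\<lambda>t. (\<Sum>k<K. p k * admit_prob k * (mean_visits k t / t)) =
      expectation (revenue t) / t) at_top"
    using eventually_ge_at_top[of 0]
    by eventually_elim (simp add: expectation_revenue sum_divide_distrib)
  ultimately have "((\<lambda>t. expectation (revenue t) / t) \<longlongrightarrow> (\<Sum>k<K. p k * admit_prob k * L k)) at_top"
    by (rule Lim_transform_eventually)
  moreover from this have "revenue_rate M U S V K p = (\<Sum>k<K. p k * admit_prob k * L k)"
    unfolding revenue_rate_def by (intro tendsto_Lim) auto
  ultimately show ?thesis by simp
qed

end

section \<open>Comparison with a uniform price\<close>

lemma (in nonneg_pricing_system) expectation_revenue_uniform:
  assumes "\<And>k. p k = x" "0 \<le> t"
  shows "expectation (revenue t) = x * prob {\<omega> \<in> space M. x \<le> V 1 \<omega>} * (\<Sum>k<K. mean_visits k t)"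
  unfolding expectation_revenue[OF assms(2)] sum_distrib_left
  by (intro sum.cong) (auto simp: admit_prob_def assms(1))

lemma (in nonneg_pricing_system) mean_arrivals_le:
  assumes t: "0 \<le> t" and K: "1 \<le> K"
    and \<beta>: "\<beta> = (1 - laplace_stieltjes M (U 1) \<mu>) / laplace_stieltjes M (U 1) \<mu>"
  shows "mean_arrivals t \<le> (1 + 1 / (\<beta> * real K)) * (\<Sum>k<K. mean_visits k t)"
proof -
  let ?\<phi> = "laplace_stieltjes M (U 1) \<mu>"
  have \<phi>: "0 < ?\<phi>" "?\<phi> < 1" by (rule laplace_stieltjes_bounds)+
  hence \<beta>_pos: "0 < \<beta>" by (simp add: \<beta>)
  have "\<beta> * real K * mean_visits K t \<le> (\<Sum>k<K. mean_visits k t)"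
    using mean_visits_full_le[OF t] \<phi> unfolding \<beta> by (simp add: field_simps)
  hence "mean_visits K t \<le> (\<Sum>k<K. mean_visits k t) / (\<beta> * real K)"
    using \<beta>_pos K by (simp add: field_simps)
  moreover have "mean_arrivals t = (\<Sum>k<K. mean_visits k t) + mean_visits K t"
    unfolding sum_mean_visits[OF t, symmetric] by (simp add: lessThan_Suc_atMost[symmetric])
  ultimately show ?thesis by (simp add: algebra_simps)
qed

text \<open>The price found is one of the \<open>p k\<close> and may be 0, which lies outside the
  range of the optimal uniform price; the theorem treats that case separately.\<close>

lemma revenue_rate_le_uniform:
  assumes "nonneg_pricing_system M U S V arr_rate \<mu>" and K: "1 \<le> K"
    and p: "\<And>k. k < K \<Longrightarrow> 0 \<le> p k"
    and \<beta>: "\<beta> = (1 - laplace_stieltjes M (U 1) \<mu>) / laplace_stieltjes M (U 1) \<mu>"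
  obtains x where "0 \<le> x"
    "revenue_rate M U S V K p \<le> (1 + 1 / (\<beta> * real K)) * revenue_rate M U S V K (\<lambda>_. x)"
proof -
  interpret P: nonneg_pricing_system M U S V arr_rate \<mu> K p by fact
  define r where "r x = x * P.prob {\<omega> \<in> space M. x \<le> V 1 \<omega>}" for x
  have "Max ((\<lambda>k. r (p k)) ` {..<K}) \<in> (\<lambda>k. r (p k)) ` {..<K}"
    using K by (intro Max_in) (auto simp: lessThan_empty_iff)
  then obtain l where l: "l < K" "Max ((\<lambda>k. r (p k)) ` {..<K}) = r (p l)" by auto
  have r_le: "r (p k) \<le> r (p l)" if "k < K" for k
    unfolding l(2)[symmetric] using that by (intro Max_ge) auto
  define x where "x = p l"
  have x: "0 \<le> x" using p l(1) by (simp add: x_def)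
  have r_nonneg: "0 \<le> r x" using x by (simp add: r_def)
  interpret Q: nonneg_pricing_system M U S V arr_rate \<mu> K "\<lambda>_. x" by fact
  let ?c = "1 + 1 / (\<beta> * real K)"
  have le: "P.expectation (P.revenue t) / t \<le> ?c * (P.expectation (Q.revenue t) / t)" if t: "0 < t" for t
  proof -
    have "P.expectation (P.revenue t) = (\<Sum>k<K. r (p k) * P.mean_visits k t)"
      using t by (auto simp: P.expectation_revenue P.admit_prob_def r_def intro!: sum.cong)
    also have "\<dots> \<le> (\<Sum>k<K. r x * P.mean_visits k t)"
      using t P.mean_visits_nonneg r_le by (intro sum_mono mult_right_mono) (auto simp: x_def)
    also have "\<dots> \<le> (\<Sum>k\<le>K. r x * P.mean_visits k t)"
      using t P.mean_visits_nonneg r_nonneg by (intro sum_mono2) auto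
    also have "\<dots> = r x * P.mean_arrivals t"
      using t by (simp add: sum_distrib_left[symmetric] P.sum_mean_visits)
    \<comment> \<open>The arrival process is the same whatever the prices, so the arrivals of
      \<open>P\<close> can be bounded through the visits of \<open>Q\<close>.\<close>
    also have "\<dots> \<le> r x * (?c * (\<Sum>k<K. Q.mean_visits k t))"
      using t r_nonneg by (intro mult_left_mono Q.mean_arrivals_le[OF _ K \<beta>]) auto
    also have "\<dots> = ?c * P.expectation (Q.revenue t)"
      using t Q.expectation_revenue_uniform[of x t] by (simp add: r_def)
    finally show ?thesis using t by (simp add: divide_right_mono)
  qed
  have "revenue_rate M U S V K p \<le> ?c * revenue_rate M U S V K (\<lambda>_. x)"
  proof (rule tendsto_le[OF _ _ P.revenue_rate_tendsto])
    show "((\<lambda>t. ?c * (P.expectation (Q.revenue t) / t)) \<longlongrightarrow> ?c * revenue_rate M U S V K (\<lambda>_. x)) at_top"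
      by (intro tendsto_mult tendsto_const Q.revenue_rate_tendsto)
    show "\<forall>\<^sub>F t in at_top. P.expectation (P.revenue t) / t \<le> ?c * (P.expectation (Q.revenue t) / t)"
      using eventually_gt_at_top[of 0] by eventually_elim (rule le)
  qed simp
  thus thesis using that x by blast
qed

lemma (in nonneg_pricing_system) revenue_rate_nonneg:
  assumes "\<And>k. k < K \<Longrightarrow> 0 \<le> p k"
  shows "0 \<le> revenue_rate M U S V K p"
proof (rule tendsto_lowerbound[OF revenue_rate_tendsto])
  show "\<forall>\<^sub>F t in at_top. 0 \<le> expectation (revenue t) / t"
    using eventually_gt_at_top[of 0]
  proof eventually_elim
    case (elim t)
    thus ?case
      using assms admit_prob_bounds mean_visits_nonneg[of t]
      by (auto simp: expectation_revenue intro!: divide_nonneg_pos sum_nonneg mult_nonneg_nonneg)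
  qed
qed simp

section \<open>Reduction to interarrival times that are nonnegative everywhere\<close>

context pricing_system
begin

lemma nonneg_pricing_system_max: "nonneg_pricing_system M (\<lambda>n \<omega>. max 0 (U n \<omega>)) S V arr_rate \<mu>"
proof
  let ?Y = "\<lambda>i :: nat + nat + nat. case i of Inl _ \<Rightarrow> max 0 | Inr _ \<Rightarrow> (\<lambda>x::real. x)"
  have "indep_vars (\<lambda>_. borel) (\<lambda>i \<omega>. ?Y i (driver i \<omega>)) driver_index"
    by (rule indep_vars_compose2[OF indep]) (auto split: sum.split)
  also have "(\<lambda>i \<omega>. ?Y i (driver i \<omega>)) = case_sum (\<lambda>n \<omega>. max 0 (U n \<omega>)) (case_sum S V)"
    by (auto simp: fun_eq_iff split: sum.split)
  finally show "indep_vars (\<lambda>_. borel) (case_sum (\<lambda>n \<omega>. max 0 (U n \<omega>)) (case_sum S V)) driver_index" .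
  have U1 [measurable]: "U 1 \<in> borel_measurable M" by (rule measurable_U) simp
  show "distr M borel (\<lambda>\<omega>. max 0 (U n \<omega>)) = distr M borel (\<lambda>\<omega>. max 0 (U 1 \<omega>))" if n: "1 \<le> n" for n
  proof -
    have "distr M borel (\<lambda>\<omega>. max 0 (U m \<omega>)) = distr (distr M borel (U m)) borel (max 0)" if "1 \<le> m" for m
      using measurable_U[OF that] by (subst distr_distr) (auto simp: comp_def)
    thus ?thesis using U_distr[OF n] n by simp
  qed
  have eq: "AE \<omega> in M. U 1 \<omega> = max 0 (U 1 \<omega>)"
    using U_nonneg[OF order_refl] by eventually_elim simp
  show "integrable M (\<lambda>\<omega>. max 0 (U 1 \<omega>))"
    using U_mean(1) integrable_cong_AE[OF _ _ eq] by simp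
  have "expectation (U 1) = expectation (\<lambda>\<omega>. max 0 (U 1 \<omega>))"
    by (rule integral_cong_AE[OF _ _ eq]) measurable
  thus "expectation (\<lambda>\<omega>. max 0 (U 1 \<omega>)) = 1 / arr_rate"
    using U_mean(2) by simp
  show "AE \<omega> in M. 0 \<le> max 0 (U n \<omega>)" "0 \<le> max 0 (U n \<omega>)" for n \<omega> by simp_all
qed (fact rate_pos S_exponential V_distr V_pos V_cdf_continuous V_mean)+

text \<open>Off a countable union of null sets all interarrival times agree, hence so do the whole
  paths.\<close>

lemma revenue_rate_max: "revenue_rate M (\<lambda>n \<omega>. max 0 (U n \<omega>)) S V = revenue_rate M U S V"
proof (intro ext)
  fix K p
  interpret N: nonneg_pricing_system M "\<lambda>n \<omega>. max 0 (U n \<omega>)" S V arr_rate \<mu> K p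
    by (rule nonneg_pricing_system_max)
  have "AE \<omega> in M. \<forall>n. 1 \<le> n \<longrightarrow> 0 \<le> U n \<omega>"
    using U_nonneg unfolding AE_all_countable by (auto simp: AE_conj_iff)
  hence eq: "AE \<omega> in M. N.revenue t \<omega> =
      cumulative_revenue K p (\<lambda>n. U n \<omega>) (\<lambda>n. S n \<omega>) (\<lambda>n. V n \<omega>) t" for t
  proof eventually_elim
    case (elim \<omega>)
    have "arrival_time (\<lambda>n. max 0 (U n \<omega>)) = arrival_time (\<lambda>n. U n \<omega>)"
      unfolding arrival_time_def using elim by (intro ext sum.cong) auto
    moreover from this have "busy K p (\<lambda>n. max 0 (U n \<omega>)) s v n = busy K p (\<lambda>n. U n \<omega>) s v n" for s v n
      by (intro busy_cong) simp_all
    ultimately show ?case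
      unfolding cumulative_revenue_def num_arrivals_def by simp
  qed
  show "revenue_rate M (\<lambda>n \<omega>. max 0 (U n \<omega>)) S V K p = revenue_rate M U S V K p"
    unfolding revenue_rate_def
    using integral_cong_AE[OF N.measurable_cumulative_revenue measurable_cumulative_revenue eq] by simp
qed

lemma laplace_stieltjes_max: "laplace_stieltjes M (\<lambda>\<omega>. max 0 (U 1 \<omega>)) s = laplace_stieltjes M (U 1) s"
  unfolding laplace_stieltjes_def
proof (rule integral_cong_AE)
  have [measurable]: "U 1 \<in> borel_measurable M" by (rule measurable_U) simp
  show "(\<lambda>\<omega>. exp (- s * max 0 (U 1 \<omega>))) \<in> borel_measurable M"
    "(\<lambda>\<omega>. exp (- s * U 1 \<omega>)) \<in> borel_measurable M" by measurable
  show "AE \<omega> in M. exp (- s * max 0 (U 1 \<omega>)) = exp (- s * U 1 \<omega>)"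
    using U_nonneg[OF order_refl] by eventually_elim simp
qed

end

theorem corollary13:
  fixes M :: "'a measure" and U S V :: "nat \<Rightarrow> 'a \<Rightarrow> real"
    and arr_rate \<mu> \<beta>\<^sub>1 popt :: real and K :: nat and pstar :: "nat \<Rightarrow> real"
    and \<phi> :: "real \<Rightarrow> real" and R :: "nat \<Rightarrow> (nat \<Rightarrow> real) \<Rightarrow> real"
  assumes "pricing_system M U S V arr_rate \<mu>"
    and "1 \<le> K"
  defines "R \<equiv> revenue_rate M U S V"
    and "\<phi> \<equiv> laplace_stieltjes M (U 1)"
    and "\<beta>\<^sub>1 \<equiv> (1 - \<phi> \<mu>) / \<phi> \<mu>"
  assumes "is_arg_max (R K) (\<lambda>p. p \<in> price_vectors K) pstar"
    and "is_arg_max (\<lambda>x. R K (\<lambda>_. x)) (\<lambda>x. 0 < x) popt"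
  shows "R K pstar - R K (\<lambda>_. popt) \<le> 1 / (\<beta>\<^sub>1 * real K) * R K (\<lambda>_. popt)"
proof -
  interpret pricing_system M U S V arr_rate \<mu> by fact
  let ?U = "\<lambda>n \<omega>. max 0 (U n \<omega>)"
  note nonneg = nonneg_pricing_system_max
  have R: "R = revenue_rate M ?U S V" by (simp add: R_def revenue_rate_max)
  have \<beta>: "\<beta>\<^sub>1 = (1 - laplace_stieltjes M (?U 1) \<mu>) / laplace_stieltjes M (?U 1) \<mu>"
    by (simp only: \<beta>\<^sub>1_def \<phi>_def laplace_stieltjes_max)
  interpret N: nonneg_pricing_system M ?U S V arr_rate \<mu> K "\<lambda>_. popt" by (rule nonneg)
  have \<beta>_pos: "0 < \<beta>\<^sub>1" using N.laplace_stieltjes_bounds by (simp add: \<beta>)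
  have popt_pos: "0 < popt" using assms(7) by (simp add: is_arg_max_def)
  have popt_max: "R K (\<lambda>_. x) \<le> R K (\<lambda>_. popt)" if "0 < x" for x
  proof -
    have "\<not> R K (\<lambda>_. popt) < R K (\<lambda>_. x)"
      using conjunct2[OF assms(7)[unfolded is_arg_max_def]] that by blast
    thus "R K (\<lambda>_. x) \<le> R K (\<lambda>_. popt)" by (rule leI)
  qed
  have R_popt: "0 \<le> R K (\<lambda>_. popt)"
    unfolding R using popt_pos by (intro N.revenue_rate_nonneg) simp
  have "0 \<le> pstar k" if "k < K" for k
    using assms(6) that by (auto simp: is_arg_max_def price_vectors_def)
  then obtain x where x: "0 \<le> x" "R K pstar \<le> (1 + 1 / (\<beta>\<^sub>1 * real K)) * R K (\<lambda>_. x)"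
    using revenue_rate_le_uniform[OF nonneg assms(2) _ \<beta>] unfolding R by blast
  have "R K (\<lambda>_. x) \<le> R K (\<lambda>_. popt)"
  \<comment> \<open>\<open>popt\<close> is optimal among positive prices only. The price 0 earns
    nothing, and \<open>popt\<close> has a nonnegative rate.\<close>
  proof (cases "x = 0")
    case True
    have "R K (\<lambda>_. 0) = 0"
      by (simp add: R_def revenue_rate_def cumulative_revenue_def tendsto_Lim)
    thus ?thesis using True R_popt by simp
  next
    case False
    thus ?thesis using x(1) popt_max by simp
  qed
  hence "(1 + 1 / (\<beta>\<^sub>1 * real K)) * R K (\<lambda>_. x) \<le> (1 + 1 / (\<beta>\<^sub>1 * real K)) * R K (\<lambda>_. popt)"
    using \<beta>_pos by (intro mult_left_mono) auto
  with x(2) show ?thesis by (simp add: distrib_right)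
qed

end
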